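(* Suppose $|\Gamma^{\mathrm D}|>0$, let the symmetric bilinear form $a_h(\cdot,\cdot)$ be positive definite on $\vec V^h$, let the pair $(\vec V^h,Q^h)$ be nondegenerate, in the sense that, for $q\in Q^h$, $(q,\nabla\cdot\boldsymbol v)_\Omega=0$ for all $\boldsymbol v\in\vec V^h$ implies $q=0$, and assume also that $\nabla\cdot\vec V^h=Q^h$. Then for every $\gamma>0$ the nonlinear system of finding $(\boldsymbol u^h,p^h)\in\vec V^h_{\boldsymbol g}\times Q^h$ such that $$a_h(\boldsymbol u^h,\boldsymbol v)-\int_\Omega\tfrac1\gamma[\gamma p^h-\nabla\cdot\boldsymbol u^h]_+\nabla\cdot\boldsymbol v\,\mathrm d\Omega=L(\boldsymbol v)\qquad\forall\boldsymbol v\in\vec V^h,$$ $$\int_\Omega\left(\tfrac1\gamma[\gamma p^h-\nabla\cdot\boldsymbol u^h]_+-p^h\right)q\,\mathrm d\Omega=0\qquad\forall q\in Q^h$$ has a unique solution.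
   Context: Let $n\in\{2,3\}$, let $\Omega\subset\mathbb R^n$ be a bounded connected polygonal/polyhedral Lipschitz domain with outward unit normal $\boldsymbol n$, and let $\partial\Omega$ be split into disjoint relatively open parts $\Gamma^{\mathrm D},\Gamma^{\mathrm N},\Gamma^{\mathrm S},\Gamma^{\mathrm E}$ (closures covering $\partial\Omega$). $\mathcal T^h$ is a conforming simplicial mesh of $\Omega$ resolving the boundary partition, and $\Gamma^{\mathrm N}\cup\Gamma^{\mathrm E}$ contains at least one complete boundary face. $[x]_+=\max(0,x)$; $\nabla\cdot$ acts elementwise on discrete fields; $[\![\cdot]\!]$ is the jump across an interior face and the trace on a boundary face; $\boldsymbol I$ is the identity. $\vec V^h_{\boldsymbol w}$ is the set of $\boldsymbol v\in[L_2(\Omega)]^n$ with $\boldsymbol v|_T\in[\mathbb P_1(T)]^n$ for all $T$; $\int_F[\![\boldsymbol v]\!]=\boldsymbol 0$ for interior faces; $\int_F(\boldsymbol v-\boldsymbol w)=\boldsymbol 0$ for $F\subset\Gamma^{\mathrm D}$; $\int_F\boldsymbol v\cdot\boldsymbol n=0$ for $F\subset\Gamma^{\mathrm S}$; $\int_F(\boldsymbol I-\boldsymbol n\otimes\boldsymbol n)\boldsymbol v=\boldsymbol 0$ for $F\subset\Gamma^{\mathrm E}$; $\vec V^h=\vec V^h_{\boldsymbol 0}$. $Q^h$ is the space of elementwise constants. $\boldsymbol g$ is given Dirichlet data on $\Gamma^{\mathrm D}$. The form $a_h$ of the paper is, for constant $\mu>0$, $\gamma_1>0$, $\boldsymbol\varepsilon(\boldsymbol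 u)=\frac12(\nabla\boldsymbol u+(\nabla\boldsymbol u)^{\mathrm T})$ and $\boldsymbol\sigma(\boldsymbol u,0)=2\mu(\boldsymbol\varepsilon(\boldsymbol u)-\frac13(\nabla\cdot\boldsymbol u)\boldsymbol I)$, $$a_h(\boldsymbol u,\boldsymbol v)=\sum_T(\boldsymbol\sigma(\boldsymbol u,0),\boldsymbol\varepsilon(\boldsymbol v))_T+2\mu\gamma_1\sum_F(h_F^{-1}[\![\boldsymbol u]\!],[\![\boldsymbol v]\!])_F,$$ the face sum running over interior faces and faces on $\Gamma^{\mathrm D}$ and $\Gamma^{\mathrm E}$, with the jump on $\Gamma^{\mathrm E}$ replaced by the tangential trace $(\boldsymbol I-\boldsymbol n\otimes\boldsymbol n)\boldsymbol v$, and $h_F=(|T^+|+|T^-|)/(2|F|)$ ($h_F=|T|/|F|$ on a boundary face); the statement only uses that $a_h$ is a symmetric bilinear form on the Crouzeix--Raviart fields that is positive definite on $\vec V^h$. $L(\boldsymbol v)=\int_\Omega\boldsymbol f\cdot\boldsymbol v+\int_{\Gamma^{\mathrm N}}\boldsymbol t\cdot\boldsymbol v\,\mathrm ds-\int_{\Gamma^{\mathrm E}}p_{\mathrm b}\,\boldsymbol v\cdot\boldsymbol n\,\mathrm ds$ with given square-integrable data. *)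

theory Defs
  imports "HOL-Analysis.Analysis"
begin

section \<open>Domain, boundary partition and mesh\<close>

text \<open>Near each boundary point the domain lies strictly on one side of the graph, over a hyperplane
  orthogonal to a unit vector \<open>e\<close>, of a Lipschitz function \<open>\<phi>\<close>.\<close>

definition lipschitz_domain :: "'a::euclidean_space set \<Rightarrow> bool" where
  "lipschitz_domain \<Omega> \<longleftrightarrow>
     (\<forall>x\<in>frontier \<Omega>. \<exists>U e \<phi> C. open U \<and> x \<in> U \<and> norm e = 1 \<and>
        C-lipschitz_on {z. z \<bullet> e = 0} \<phi> \<and>
        \<Omega> \<inter> U = {y \<in> U. \<phi> (y - (y \<bullet> e) *\<^sub>R e) < y \<bullet> e})"

definition polyhedral_lipschitz_domain :: "'a::euclidean_space set \<Rightarrow> bool" where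
  "polyhedral_lipschitz_domain \<Omega> \<longleftrightarrow>
     open \<Omega> \<and> connected \<Omega> \<and> bounded \<Omega> \<and> \<Omega> \<noteq> {} \<and> lipschitz_domain \<Omega> \<and>
     (\<exists>\<P>. finite \<P> \<and> (\<forall>P\<in>\<P>. polytope P) \<and> closure \<Omega> = \<Union>\<P>)"

definition boundary_partition ::
  "'a::euclidean_space set \<Rightarrow> 'a set \<Rightarrow> 'a set \<Rightarrow> 'a set \<Rightarrow> 'a set \<Rightarrow> bool" where
  "boundary_partition \<Omega> \<Gamma>D \<Gamma>N \<Gamma>S \<Gamma>E \<longleftrightarrow>
     (\<forall>\<Gamma>\<in>{\<Gamma>D, \<Gamma>N, \<Gamma>S, \<Gamma>E}. openin (top_of_set (frontier \<Omega>)) \<Gamma>) \<and>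
     \<Gamma>D \<inter> \<Gamma>N = {} \<and> \<Gamma>D \<inter> \<Gamma>S = {} \<and> \<Gamma>D \<inter> \<Gamma>E = {} \<and>
     \<Gamma>N \<inter> \<Gamma>S = {} \<and> \<Gamma>N \<inter> \<Gamma>E = {} \<and> \<Gamma>S \<inter> \<Gamma>E = {} \<and>
     closure \<Gamma>D \<union> closure \<Gamma>N \<union> closure \<Gamma>S \<union> closure \<Gamma>E = frontier \<Omega>"

text \<open>Elements are closed simplices. Conformity (two elements meet in a common face, possibly empty)
  is part of \<^const>\<open>triangulation\<close>.\<close>

definition conforming_mesh :: "(real^'n::finite) set \<Rightarrow> (real^'n) set set \<Rightarrow> bool" where
  "conforming_mesh \<Omega> \<T> \<longleftrightarrow>
     triangulation \<T> \<and> (\<forall>T\<in>\<T>. int CARD('n) simplex T) \<and> \<Union>\<T> = closure \<Omega>"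

definition mesh_faces :: "'a::euclidean_space set set \<Rightarrow> 'a set set" where
  "mesh_faces \<T> = {F. \<exists>T\<in>\<T>. F facet_of T}"

text \<open>Faces are closed sets while the boundary parts are relatively open, so a face counts as lying
  on \<open>\<Gamma>\<close> if its relative interior does. The boundary faces are \<open>faces_on \<T> (frontier \<Omega>)\<close>.\<close>

definition faces_on :: "'a::euclidean_space set set \<Rightarrow> 'a set \<Rightarrow> 'a set set" where
  "faces_on \<T> \<Gamma> = {F \<in> mesh_faces \<T>. rel_interior F \<subseteq> \<Gamma>}"

definition interior_faces :: "'a::euclidean_space set set \<Rightarrow> 'a set set" where
  "interior_faces \<T> = {F. \<exists>T\<in>\<T>. \<exists>T'\<in>\<T>. T \<noteq> T' \<and> F facet_of T \<and> F facet_of T'}"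

definition resolves_partition ::
  "'a::euclidean_space set \<Rightarrow> 'a set \<Rightarrow> 'a set \<Rightarrow> 'a set \<Rightarrow> 'a set \<Rightarrow> 'a set set \<Rightarrow> bool" where
  "resolves_partition \<Omega> \<Gamma>D \<Gamma>N \<Gamma>S \<Gamma>E \<T> \<longleftrightarrow>
     (\<forall>F\<in>faces_on \<T> (frontier \<Omega>). \<exists>\<Gamma>\<in>{\<Gamma>D, \<Gamma>N, \<Gamma>S, \<Gamma>E}. F \<in> faces_on \<T> \<Gamma>)"

text \<open>\<open>T\<^sup>+\<close> and \<open>T\<^sup>-\<close> of a face. On a boundary face \<open>T\<^sup>+\<close> is the only adjacent element. The choice on an
  interior face only fixes the sign of jumps, which cancels wherever they are used below.\<close>

definition elem_plus :: "'a::euclidean_space set set \<Rightarrow> 'a set \<Rightarrow> 'a set" where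
  "elem_plus \<T> F = (SOME T. T \<in> \<T> \<and> F facet_of T)"

definition elem_minus :: "'a::euclidean_space set set \<Rightarrow> 'a set \<Rightarrow> 'a set" where
  "elem_minus \<T> F = (SOME T. T \<in> \<T> \<and> F facet_of T \<and> T \<noteq> elem_plus \<T> F)"

text \<open>Unit normal of a boundary face pointing out of its element, hence out of the domain.\<close>

definition outer_normal :: "'a::euclidean_space set set \<Rightarrow> 'a set \<Rightarrow> 'a" where
  "outer_normal \<T> F =
     (THE \<nu>. norm \<nu> = 1 \<and> (\<forall>x\<in>F. \<forall>y\<in>elem_plus \<T> F. \<nu> \<bullet> (y - x) \<le> 0))"

section \<open>Surface integration\<close>

text \<open>Surface measure on a flat piece \<open>F\<close> of a hyperplane with unit normal \<open>\<nu>\<close>. The prism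
  \<open>F + [0,1] \<nu>\<close> carries the product of surface measure on \<open>F\<close> and Lebesgue measure on \<open>[0,1]\<close>,
  so orthogonal projection of Lebesgue measure on the prism back onto \<open>F\<close> gives surface measure.\<close>

definition face_unit_normal :: "'a::euclidean_space set \<Rightarrow> 'a" where
  "face_unit_normal F = (SOME \<nu>. norm \<nu> = 1 \<and> (\<forall>x\<in>F. \<forall>y\<in>F. \<nu> \<bullet> (x - y) = 0))"

definition face_prism :: "'a::euclidean_space set \<Rightarrow> 'a set" where
  "face_prism F = {x + s *\<^sub>R face_unit_normal F | x s. x \<in> F \<and> 0 \<le> s \<and> s \<le> 1}"

definition face_proj :: "'a::euclidean_space set \<Rightarrow> 'a \<Rightarrow> 'a" where
  "face_proj F z = z - ((z - (SOME a. a \<in> F)) \<bullet> face_unit_normal F) *\<^sub>R face_unit_normal F"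

definition face_measure :: "'a::euclidean_space set \<Rightarrow> 'a measure" where
  "face_measure F = distr (restrict_space lborel (face_prism F)) borel (face_proj F)"

definition face_area :: "'a::euclidean_space set \<Rightarrow> real" where
  "face_area F = measure (face_measure F) F"

definition surface_area :: "'a::euclidean_space set set \<Rightarrow> 'a set \<Rightarrow> real" where
  "surface_area \<T> \<Gamma> = (\<Sum>F\<in>faces_on \<T> \<Gamma>. face_area F)"

definition square_integrable :: "'a measure \<Rightarrow> ('a \<Rightarrow> 'b::{banach,second_countable_topology}) \<Rightarrow> bool" where
  "square_integrable M f \<longleftrightarrow> f \<in> borel_measurable M \<and> integrable M (\<lambda>x. (norm (f x))\<^sup>2)"

section \<open>Discrete fields\<close>

text \<open>An elementwise polynomial field is a class in \<open>L\<^sub>2\<close>, determined by its values in the interiors of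
  the elements. It is represented by the member of the class that vanishes on the mesh skeleton and
  outside the mesh, so that equality of functions is equality in \<open>L\<^sub>2\<close>. Square integrability is
  automatic.\<close>

definition mesh_interior :: "'a::euclidean_space set set \<Rightarrow> 'a set" where
  "mesh_interior \<T> = (\<Union>T\<in>\<T>. interior T)"

definition broken_P1 :: "(real^'n::finite) set set \<Rightarrow> (real^'n \<Rightarrow> real^'n) set" where
  "broken_P1 \<T> = {v. (\<forall>T\<in>\<T>. \<exists>A b. \<forall>x\<in>interior T. v x = A *v x + b) \<and>
                     (\<forall>x. x \<notin> mesh_interior \<T> \<longrightarrow> v x = 0)}"

definition broken_P0 :: "(real^'n::finite) set set \<Rightarrow> (real^'n \<Rightarrow> real) set" where
  "broken_P0 \<T> = {q. (\<forall>T\<in>\<T>. \<exists>c. \<forall>x\<in>interior T. q x = c) \<and>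
                     (\<forall>x. x \<notin> mesh_interior \<T> \<longrightarrow> q x = 0)}"

definition broken_grad :: "(real^'n::finite) set set \<Rightarrow> (real^'n \<Rightarrow> real^'n) \<Rightarrow> real^'n \<Rightarrow> real^'n^'n" where
  "broken_grad \<T> v x = (if x \<in> mesh_interior \<T> then jacobian v (at x) else 0)"

definition broken_div :: "(real^'n::finite) set set \<Rightarrow> (real^'n \<Rightarrow> real^'n) \<Rightarrow> real^'n \<Rightarrow> real" where
  "broken_div \<T> v x = trace (broken_grad \<T> v x)"

definition elem_trace ::
  "'a::euclidean_space set \<Rightarrow> ('a \<Rightarrow> 'b::t2_space) \<Rightarrow> 'a \<Rightarrow> 'b" where
  "elem_trace T v x = Lim (at x within interior T) v"

definition jump :: "(real^'n::finite) set set \<Rightarrow> (real^'n) set \<Rightarrow> (real^'n \<Rightarrow> real^'n) \<Rightarrow> real^'n \<Rightarrow> real^'n" where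
  "jump \<T> F v x =
     (if F \<in> interior_faces \<T> then elem_trace (elem_plus \<T> F) v x - elem_trace (elem_minus \<T> F) v x
      else elem_trace (elem_plus \<T> F) v x)"

text \<open>The map \<open>(I - n \<otimes> n) y\<close>.\<close>

definition tangential :: "'a::real_inner \<Rightarrow> 'a \<Rightarrow> 'a" where
  "tangential n y = y - (y \<bullet> n) *\<^sub>R n"

definition CR_space ::
  "(real^'n::finite) set set \<Rightarrow> (real^'n) set \<Rightarrow> (real^'n) set \<Rightarrow> (real^'n) set \<Rightarrow>
   (real^'n \<Rightarrow> real^'n) \<Rightarrow> (real^'n \<Rightarrow> real^'n) set" where
  "CR_space \<T> \<Gamma>D \<Gamma>S \<Gamma>E w = {v \<in> broken_P1 \<T>.
     (\<forall>F\<in>interior_faces \<T>. (LINT x|face_measure F. jump \<T> F v x) = 0) \<and>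
     (\<forall>F\<in>faces_on \<T> \<Gamma>D. (LINT x|face_measure F. jump \<T> F v x - w x) = 0) \<and>
     (\<forall>F\<in>faces_on \<T> \<Gamma>S. (LINT x|face_measure F. jump \<T> F v x \<bullet> outer_normal \<T> F) = 0) \<and>
     (\<forall>F\<in>faces_on \<T> \<Gamma>E. (LINT x|face_measure F. tangential (outer_normal \<T> F) (jump \<T> F v x)) = 0)}"

section \<open>Forms\<close>

definition strain :: "(real^'n::finite) set set \<Rightarrow> (real^'n \<Rightarrow> real^'n) \<Rightarrow> real^'n \<Rightarrow> real^'n^'n" where
  "strain \<T> u x = (1/2) *\<^sub>R (broken_grad \<T> u x + transpose (broken_grad \<T> u x))"

text \<open>The stress at zero pressure. The factor \<open>1/3\<close> is used in two dimensions as well.\<close>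

definition stress0 :: "real \<Rightarrow> (real^'n::finite) set set \<Rightarrow> (real^'n \<Rightarrow> real^'n) \<Rightarrow> real^'n \<Rightarrow> real^'n^'n" where
  "stress0 \<mu> \<T> u x = (2 * \<mu>) *\<^sub>R (strain \<T> u x - (1/3 * broken_div \<T> u x) *\<^sub>R mat 1)"

definition face_size :: "(real^'n::finite) set set \<Rightarrow> (real^'n) set \<Rightarrow> real" where
  "face_size \<T> F =
     (if F \<in> interior_faces \<T>
      then (measure lebesgue (elem_plus \<T> F) + measure lebesgue (elem_minus \<T> F)) / (2 * face_area F)
      else measure lebesgue (elem_plus \<T> F) / face_area F)"

text \<open>The inner product on \<^typ>\<open>real^'n^'n\<close> is the Frobenius product.\<close>

definition a_form ::
  "real \<Rightarrow> real \<Rightarrow> (real^'n::finite) set set \<Rightarrow> (real^'n) set \<Rightarrow> (real^'n) set \<Rightarrow>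
   (real^'n \<Rightarrow> real^'n) \<Rightarrow> (real^'n \<Rightarrow> real^'n) \<Rightarrow> real" where
  "a_form \<mu> \<gamma>\<^sub>1 \<T> \<Gamma>D \<Gamma>E u v =
     (\<Sum>T\<in>\<T>. LINT x|lebesgue_on T. stress0 \<mu> \<T> u x \<bullet> strain \<T> v x) +
     2 * \<mu> * \<gamma>\<^sub>1 *
      ((\<Sum>F\<in>interior_faces \<T> \<union> faces_on \<T> \<Gamma>D.
          LINT x|face_measure F. (1 / face_size \<T> F) * (jump \<T> F u x \<bullet> jump \<T> F v x)) +
       (\<Sum>F\<in>faces_on \<T> \<Gamma>E.
          LINT x|face_measure F. (1 / face_size \<T> F) *
            (tangential (outer_normal \<T> F) (jump \<T> F u x) \<bullet>
             tangential (outer_normal \<T> F) (jump \<T> F v x))))"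

text \<open>Since the mesh resolves the partition, a boundary part is, up to a set of surface measure zero,
  the union of the non-overlapping faces lying on it.\<close>

definition load ::
  "(real^'n::finite) set \<Rightarrow> (real^'n) set set \<Rightarrow> (real^'n) set \<Rightarrow> (real^'n) set \<Rightarrow>
   (real^'n \<Rightarrow> real^'n) \<Rightarrow> (real^'n \<Rightarrow> real^'n) \<Rightarrow> (real^'n \<Rightarrow> real) \<Rightarrow> (real^'n \<Rightarrow> real^'n) \<Rightarrow> real" where
  "load \<Omega> \<T> \<Gamma>N \<Gamma>E f t p\<^sub>b v =
     (LINT x|lebesgue_on \<Omega>. f x \<bullet> v x) +
     (\<Sum>F\<in>faces_on \<T> \<Gamma>N. LINT x|face_measure F. t x \<bullet> jump \<T> F v x) -
     (\<Sum>F\<in>faces_on \<T> \<Gamma>E. LINT x|face_measure F. p\<^sub>b x * (jump \<T> F v x \<bullet> outer_normal \<T> F))"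

definition pos_part :: "real \<Rightarrow> real" where
  "pos_part x = max 0 x"

end

(* The operator [gamma p - div u]_+ / gamma = p on elementwise constants says that p and div u are
   nonnegative and complementary on every element, so the system is the optimality system of a
   strictly convex quadratic problem with the constraints div u >= 0. Uniqueness follows by testing
   the difference of two solutions with itself. For existence, a field u0 satisfying the Dirichlet
   condition is interpolated elementwise, div u0 is removed by surjectivity of the divergence, and
   the remaining linear complementarity problem on a finite-dimensional space is solved by adding
   the constraints one at a time. The interpolation rests on the fact that the integral of an affine
   function over a facet is the area times the mean of the vertex values. *)
theory Submission
  imports Defs
begin

text \<open>Surjectivity of the divergence matters because it makes the constraints homogeneous:
  once the Dirichlet lift is divergence-free, each constraint is a sign condition on a linear
  functional, so an active constraint can be treated by passing to the kernel of that functional,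
  which is again a subspace. This is what lets the induction use the same statement on smaller and
  smaller spaces. The multiplier of the constraint on an element turns out to be the pressure there.
  Testing the difference of two solutions with itself settles only the velocities; the pressures
  then agree because their difference is orthogonal to all divergences, which is where nondegeneracy
  enters. The lift is built from prescribed face means: those of the data on Dirichlet faces and
  zero on all other faces. It has the right jumps only if no Dirichlet face is shared by two
  elements. A mesh of the closure could hide a slit of the domain in this way, and the Lipschitz
  condition rules it out. Surface measure is the image of volume under a projection, so the mean
  formula on facets is obtained from a symmetry of the prism instead of a parametrization.\<close>

section \<open>Complementarity problems on finite-dimensional function spaces\<close>

text \<open>One operation stands for both addition and scaling, so that subspaces and linearity
  relative to a set of functions need a single closure law each.\<close>

definition comb :: "('a \<Rightarrow> 'b::real_vector) \<Rightarrow> real \<Rightarrow> ('a \<Rightarrow> 'b) \<Rightarrow> 'a \<Rightarrow> 'b" where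
  "comb u c v = (\<lambda>x. u x + c *\<^sub>R v x)"

definition fun_subspace :: "('a \<Rightarrow> 'b::real_vector) set \<Rightarrow> bool" where
  "fun_subspace W \<longleftrightarrow> (\<lambda>_. 0) \<in> W \<and> (\<forall>u\<in>W. \<forall>v\<in>W. \<forall>c. comb u c v \<in> W)"

definition linear_fun :: "('a \<Rightarrow> 'b::real_vector) set \<Rightarrow> (('a \<Rightarrow> 'b) \<Rightarrow> real) \<Rightarrow> bool" where
  "linear_fun W \<phi> \<longleftrightarrow> (\<forall>u\<in>W. \<forall>v\<in>W. \<forall>c. \<phi> (comb u c v) = \<phi> u + c * \<phi> v)"

definition bilinear_fun ::
  "('a \<Rightarrow> 'b::real_vector) set \<Rightarrow> (('a \<Rightarrow> 'b) \<Rightarrow> ('a \<Rightarrow> 'b) \<Rightarrow> real) \<Rightarrow> bool" where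
  "bilinear_fun W a \<longleftrightarrow> (\<forall>w\<in>W. linear_fun W (a w) \<and> linear_fun W (\<lambda>u. a u w))"

lemma fun_subspace_0: "fun_subspace W \<Longrightarrow> (\<lambda>_. 0) \<in> W"
  and fun_subspace_comb: "fun_subspace W \<Longrightarrow> u \<in> W \<Longrightarrow> v \<in> W \<Longrightarrow> comb u c v \<in> W"
  by (auto simp: fun_subspace_def)

lemma linear_fun_comb: "linear_fun W \<phi> \<Longrightarrow> u \<in> W \<Longrightarrow> v \<in> W \<Longrightarrow> \<phi> (comb u c v) = \<phi> u + c * \<phi> v"
  by (auto simp: linear_fun_def)

lemma linear_fun_0: "linear_fun W \<phi> \<Longrightarrow> fun_subspace W \<Longrightarrow> \<phi> (\<lambda>_. 0) = 0"
  using linear_fun_comb[of W \<phi> "\<lambda>_. 0" "\<lambda>_. 0" 1] fun_subspace_0[of W] by (simp add: comb_def)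

lemma linear_fun_subset: "linear_fun W \<phi> \<Longrightarrow> U \<subseteq> W \<Longrightarrow> linear_fun U \<phi>"
  by (auto simp: linear_fun_def)

lemma bilinear_fun_subset: "bilinear_fun W a \<Longrightarrow> U \<subseteq> W \<Longrightarrow> bilinear_fun U a"
  by (auto simp: bilinear_fun_def intro: linear_fun_subset)

lemma bilinear_fun_comb_left:
  "bilinear_fun W a \<Longrightarrow> u \<in> W \<Longrightarrow> v \<in> W \<Longrightarrow> w \<in> W \<Longrightarrow> a (comb u c v) w = a u w + c * a v w"
  using linear_fun_comb[of W "\<lambda>u. a u w"] by (auto simp: bilinear_fun_def)

lemma bilinear_fun_comb_right:
  "bilinear_fun W a \<Longrightarrow> u \<in> W \<Longrightarrow> v \<in> W \<Longrightarrow> w \<in> W \<Longrightarrow> a w (comb u c v) = a w u + c * a w v"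
  using linear_fun_comb[of W "a w"] by (auto simp: bilinear_fun_def)

lemma linear_fun_diff:
  assumes "linear_fun W \<phi>" "linear_fun W \<psi>"
  shows "linear_fun W (\<lambda>u. \<phi> u - \<psi> u)"
  using assms by (auto simp: linear_fun_def algebra_simps)

lemma linear_fun_add:
  assumes "linear_fun W \<phi>" "linear_fun W \<psi>"
  shows "linear_fun W (\<lambda>u. \<phi> u + \<psi> u)"
  using assms by (auto simp: linear_fun_def algebra_simps)

lemma linear_fun_scale:
  assumes "linear_fun W \<phi>"
  shows "linear_fun W (\<lambda>u. r * \<phi> u)"
  using assms by (auto simp: linear_fun_def algebra_simps)

lemma linear_fun_sum:
  assumes "\<And>i. i \<in> I \<Longrightarrow> linear_fun W (\<phi> i)"
  shows "linear_fun W (\<lambda>u. \<Sum>i\<in>I. \<phi> i u)"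
  using assms by (auto simp: linear_fun_def sum.distrib sum_distrib_left)

lemma fun_subspace_kernel:
  assumes "fun_subspace W" "linear_fun W \<phi>"
  shows "fun_subspace {v \<in> W. \<phi> v = 0}"
  using assms linear_fun_0[OF assms(2,1)] by (auto simp: fun_subspace_def linear_fun_comb)

text \<open>Finite dimension of \<open>W\<close> is expressed by a finite set of functionals separating its points.\<close>

lemma finite_lax_milgram:
  fixes a :: "('a \<Rightarrow> 'b::real_vector) \<Rightarrow> ('a \<Rightarrow> 'b) \<Rightarrow> real"
  assumes "finite \<Phi>" "fun_subspace W" "\<And>\<phi>. \<phi> \<in> \<Phi> \<Longrightarrow> linear_fun W \<phi>"
    and "\<And>v. v \<in> W \<Longrightarrow> (\<And>\<phi>. \<phi> \<in> \<Phi> \<Longrightarrow> \<phi> v = 0) \<Longrightarrow> v = (\<lambda>_. 0)"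
    and "bilinear_fun W a" "\<And>v. v \<in> W \<Longrightarrow> v \<noteq> (\<lambda>_. 0) \<Longrightarrow> a v v > 0"
    and "linear_fun W L"
  shows "\<exists>u\<in>W. \<forall>v\<in>W. a u v = L v"
  using assms
proof (induction \<Phi> arbitrary: W L rule: finite_induct)
  case empty
  have "W = {\<lambda>_. 0}"
    using empty.prems(1,3) fun_subspace_0 by blast
  moreover have "linear_fun W (a (\<lambda>_. 0))"
    using empty.prems(1,4) by (auto simp: bilinear_fun_def fun_subspace_0)
  ultimately show ?case
    using empty.prems(1,6) linear_fun_0 by (metis singletonD singletonI)
next
  case (insert \<phi> \<Phi>)
  \<comment> \<open>On the kernel of \<open>\<phi>\<close> the functionals in \<open>\<Phi>\<close>
    alone separate points, so the induction hypothesis applies to \<open>U\<close>, which has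
    codimension at most one in \<open>W\<close>.\<close>
  define U where "U = {v \<in> W. \<phi> v = 0}"
  have UW: "U \<subseteq> W" by (auto simp: U_def)
  have \<phi>: "linear_fun W \<phi>" using insert.prems(2) by simp
  have U: "fun_subspace U"
    unfolding U_def using insert.prems(1) \<phi> by (rule fun_subspace_kernel)
  have sep: "v = (\<lambda>_. 0)" if "v \<in> U" "\<And>\<psi>. \<psi> \<in> \<Phi> \<Longrightarrow> \<psi> v = 0" for v
    using that insert.prems(3)[of v] by (auto simp: U_def)
  have IH: "\<exists>u\<in>U. \<forall>v\<in>U. a u v = M v" if "linear_fun U M" for M
    using UW sep insert.prems(2,5)
    by (intro insert.IH[OF U] that bilinear_fun_subset[OF insert.prems(4)])
      (auto intro: linear_fun_subset)
  note bil = bilinear_fun_comb_left[OF insert.prems(4)] bilinear_fun_comb_right[OF insert.prems(4)]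
  show ?case
  proof (cases "U = W")
    case True
    then show ?thesis using IH insert.prems(6) by auto
  next
    case False
    then obtain b where b: "b \<in> W" "\<phi> b \<noteq> 0" by (auto simp: U_def)
    have "linear_fun U (a b)"
      using insert.prems(4) b UW by (auto simp: bilinear_fun_def intro: linear_fun_subset)
    then obtain w where w: "w \<in> U" "\<And>v. v \<in> U \<Longrightarrow> a w v = a b v" using IH by metis
    \<comment> \<open>Gram-Schmidt step: \<open>w\<close> represents \<open>a b\<close> on
      \<open>U\<close>, so \<open>a b'\<close> vanishes on \<open>U\<close>, while
      \<open>\<phi> b'\<close> stays nonzero because \<open>w\<close> lies in the kernel.\<close>
    define b' where "b' = comb b (- 1) w"
    have b'W: "b' \<in> W" unfolding b'_def using b w UW insert.prems(1) by (auto intro: fun_subspace_comb)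
    have \<phi>b': "\<phi> b' = \<phi> b"
      unfolding b'_def using linear_fun_comb[OF \<phi> b(1)] w UW by (auto simp: U_def)
    then have "b' \<noteq> (\<lambda>_. 0)" using b(2) linear_fun_0[OF \<phi> insert.prems(1)] by auto
    then have pos: "a b' b' > 0" using insert.prems(5) b'W by auto
    have orth: "a b' v = 0" if "v \<in> U" for v
      using w(2)[OF that] b(1) subsetD[OF UW that] subsetD[OF UW w(1)] by (simp add: b'_def bil)
    obtain u where u: "u \<in> U" "\<And>v. v \<in> U \<Longrightarrow> a u v = L v"
      using IH[of L] insert.prems(6) UW by (metis linear_fun_subset)
    \<comment> \<open>The equation tested with \<open>b'\<close> fixes \<open>t\<close>; by
      \<open>orth\<close> the correction does not disturb the equations tested with
      \<open>U\<close>.\<close>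
    define t where "t = (L b' - a u b') / a b' b'"
    have uW: "u \<in> W" using u UW by auto
    have "a (comb u t b') v = L v" if v: "v \<in> W" for v
    proof -
      define s where "s = \<phi> v / \<phi> b'"
      define v' where "v' = comb v (- s) b'"
      have v'W: "v' \<in> W" unfolding v'_def using v b'W insert.prems(1) by (auto intro: fun_subspace_comb)
      have "\<phi> v' = 0"
        unfolding v'_def using linear_fun_comb[OF \<phi> v b'W] b(2) \<phi>b' by (simp add: s_def)
      then have v'U: "v' \<in> U" using v'W by (simp add: U_def)
      have v_eq: "v = comb v' s b'" by (auto simp: v'_def comb_def)
      have "a (comb u t b') v' = L v'"
        using u(2)[OF v'U] orth[OF v'U] by (simp add: bil uW b'W v'W)
      moreover have "a (comb u t b') b' = L b'"
        using pos by (simp add: bil uW b'W t_def)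
      ultimately show ?thesis
        unfolding v_eq using linear_fun_comb[OF insert.prems(6) v'W b'W, of s]
        by (simp add: bil uW b'W v'W fun_subspace_comb[OF insert.prems(1)])
    qed
    then show ?thesis
      using fun_subspace_comb[OF insert.prems(1) uW b'W] by blast
  qed
qed

text \<open>The constraints are added one at a time. If the solution without constraint \<open>j\<close> violates it,
  then constraint \<open>j\<close> is active: solving on the kernel of \<open>\<delta> j\<close> yields a multiplier for \<open>j\<close>, and
  testing with the difference of the two solutions shows that this multiplier is positive.\<close>

lemma complementarity_solution_exists:
  fixes a :: "('a \<Rightarrow> 'b::real_vector) \<Rightarrow> ('a \<Rightarrow> 'b) \<Rightarrow> real"
  assumes "finite I" "finite \<Phi>" "fun_subspace W" "\<And>\<phi>. \<phi> \<in> \<Phi> \<Longrightarrow> linear_fun W \<phi>"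
    and "\<And>v. v \<in> W \<Longrightarrow> (\<And>\<phi>. \<phi> \<in> \<Phi> \<Longrightarrow> \<phi> v = 0) \<Longrightarrow> v = (\<lambda>_. 0)"
    and "bilinear_fun W a" "\<And>v. v \<in> W \<Longrightarrow> v \<noteq> (\<lambda>_. 0) \<Longrightarrow> a v v > 0"
    and "linear_fun W L" "\<And>i. i \<in> I \<Longrightarrow> linear_fun W (\<delta> i)"
  shows "\<exists>u\<in>W. \<exists>p. (\<forall>i\<in>I. p i \<ge> (0::real) \<and> \<delta> i u \<ge> 0 \<and> p i * \<delta> i u = 0) \<and>
    (\<forall>v\<in>W. a u v = L v + (\<Sum>i\<in>I. p i * \<delta> i v))"
  using assms(1,3-)
\<comment> \<open>\<open>W\<close> is generalized because a violated constraint requires the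
  remaining problem to be solved again on the kernel of \<open>\<delta> j\<close>.\<close>
proof (induction I arbitrary: W rule: finite_induct)
  case empty
  have "\<exists>u\<in>W. \<forall>v\<in>W. a u v = L v"
    by (rule finite_lax_milgram[OF assms(2)]) (use empty.prems in \<open>blast+\<close>)
  then show ?case by simp
next
  case (insert j I)
  note W = insert.prems(1)
  note bil = bilinear_fun_comb_left[OF insert.prems(4)] bilinear_fun_comb_right[OF insert.prems(4)]
  have \<delta>: "linear_fun W (\<delta> i)" if "i \<in> insert j I" for i using insert.prems(7) that by auto
  obtain u p where uW: "u \<in> W" and p: "\<And>i. i \<in> I \<Longrightarrow> p i \<ge> 0 \<and> \<delta> i u \<ge> 0 \<and> p i * \<delta> i u = 0"
    and u: "\<And>v. v \<in> W \<Longrightarrow> a u v = L v + (\<Sum>i\<in>I. p i * \<delta> i v)"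
  proof -
    have "\<exists>u\<in>W. \<exists>p. (\<forall>i\<in>I. p i \<ge> (0::real) \<and> \<delta> i u \<ge> 0 \<and> p i * \<delta> i u = 0) \<and>
      (\<forall>v\<in>W. a u v = L v + (\<Sum>i\<in>I. p i * \<delta> i v))"
      by (rule insert.IH) (use insert.prems in \<open>blast+\<close>)
    then show ?thesis using that by blast
  qed
  show ?case
  proof (cases "\<delta> j u \<ge> 0")
    case True
    have "(\<Sum>i\<in>insert j I. (p(j := 0)) i * \<delta> i v) = (\<Sum>i\<in>I. p i * \<delta> i v)" for v
    proof -
      have "(\<Sum>i\<in>I. (p(j := 0)) i * \<delta> i v) = (\<Sum>i\<in>I. p i * \<delta> i v)"
        using insert.hyps(2) by (intro sum.cong) auto
      then show ?thesis using insert.hyps by simp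
    qed
    then have "\<forall>v\<in>W. a u v = L v + (\<Sum>i\<in>insert j I. (p(j := 0)) i * \<delta> i v)"
      using u by simp
    moreover have "\<forall>i\<in>insert j I. (p(j := 0)) i \<ge> 0 \<and> \<delta> i u \<ge> 0 \<and> (p(j := 0)) i * \<delta> i u = 0"
      using p True by simp
    ultimately show ?thesis using uW by blast
  next
    case False
    define U where "U = {v \<in> W. \<delta> j v = 0}"
    have UW: "U \<subseteq> W" by (auto simp: U_def)
    have U: "fun_subspace U" unfolding U_def using W \<delta> by (simp add: fun_subspace_kernel)
    obtain u' p' where u'U: "u' \<in> U" and p': "\<And>i. i \<in> I \<Longrightarrow> p' i \<ge> 0 \<and> \<delta> i u' \<ge> 0 \<and> p' i * \<delta> i u' = 0"
      and u': "\<And>v. v \<in> U \<Longrightarrow> a u' v = L v + (\<Sum>i\<in>I. p' i * \<delta> i v)"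
    proof -
      have "\<exists>u'\<in>U. \<exists>p'. (\<forall>i\<in>I. p' i \<ge> (0::real) \<and> \<delta> i u' \<ge> 0 \<and> p' i * \<delta> i u' = 0) \<and>
        (\<forall>v\<in>U. a u' v = L v + (\<Sum>i\<in>I. p' i * \<delta> i v))"
      proof (rule insert.IH[OF U])
        show "bilinear_fun U a" using insert.prems(4) UW by (rule bilinear_fun_subset)
        show "linear_fun U (\<delta> i)" if "i \<in> I" for i
          using \<delta> UW that by (auto intro!: linear_fun_subset[OF _ UW])
        show "linear_fun U \<phi>" if "\<phi> \<in> \<Phi>" for \<phi>
          using insert.prems(2) UW that by (auto intro!: linear_fun_subset[OF _ UW])
        show "linear_fun U L"
          using insert.prems(6) UW by (rule linear_fun_subset)
        show "v = (\<lambda>_. 0)" if "v \<in> U" "\<And>\<phi>. \<phi> \<in> \<Phi> \<Longrightarrow> \<phi> v = 0" for v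
          using that UW by (intro insert.prems(3)) auto
        show "a v v > 0" if "v \<in> U" "v \<noteq> (\<lambda>_. 0)" for v
          using that UW by (intro insert.prems(5)) auto
      qed
      then show ?thesis using that by blast
    qed
    have u'W: "u' \<in> W" "\<delta> j u' = 0" using u'U by (auto simp: U_def)
    \<comment> \<open>The residual of \<open>u'\<close> vanishes on the kernel of
      \<open>\<delta> j\<close>, hence is a multiple of \<open>\<delta> j\<close>; the factor is the
      multiplier sought.\<close>
    define R where "R v = a u' v - L v - (\<Sum>i\<in>I. p' i * \<delta> i v)" for v
    have R: "linear_fun W R"
      unfolding R_def using \<delta> insert.prems(4,6) u'W(1)
      by (auto intro!: linear_fun_diff linear_fun_sum linear_fun_scale simp: bilinear_fun_def)
    have RU: "R v = 0" if "v \<in> U" for v using u'[OF that] by (simp add: R_def)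
    \<comment> \<open>The violating field \<open>u\<close> serves as the vector outside the kernel
      on which the factor is read off; \<open>\<delta> j u\<close> is negative, so the division is
      legitimate.\<close>
    define q where "q = R u / \<delta> j u"
    have R_eq: "R v = q * \<delta> j v" if v: "v \<in> W" for v
    proof -
      define s where "s = \<delta> j v / \<delta> j u"
      have "comb v (- s) u \<in> U"
        using v uW False W linear_fun_comb[OF \<delta>[of j] v uW, of "- s"]
        by (auto simp: U_def s_def intro: fun_subspace_comb)
      then have "R v - s * R u = 0" using RU linear_fun_comb[OF R v uW] by force
      then show ?thesis by (simp add: q_def s_def)
    qed
    define e where "e = comb u' (- 1) u"
    have eW: "e \<in> W" unfolding e_def using u'W uW W by (auto intro: fun_subspace_comb)
    have \<delta>e: "\<delta> i e = \<delta> i u' - \<delta> i u" if "i \<in> insert j I" for i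
      unfolding e_def using linear_fun_comb[OF \<delta>[OF that] u'W(1) uW] by simp
    have "e \<noteq> (\<lambda>_. 0)"
      using \<delta>e[of j] u'W False linear_fun_0[OF \<delta>[of j] W] by auto
    then have "a e e > 0" using insert.prems(5) eW by auto
    moreover have "a e e = a u' e - a u e"
      using bil(1)[OF u'W(1) uW eW, of "- 1"] by (simp flip: e_def)
    moreover have "a u' e = L e + (\<Sum>i\<in>I. p' i * \<delta> i e) + q * \<delta> j e"
      using R_eq[OF eW] by (simp add: R_def)
    \<comment> \<open>By complementarity the products \<open>p' i * \<delta> i u'\<close> and
      \<open>p i * \<delta> i u\<close> are zero. The mixed products are nonnegative and enter the
      two sides with opposite signs.\<close>
    moreover have "(\<Sum>i\<in>I. p' i * \<delta> i e) \<le> (\<Sum>i\<in>I. p i * \<delta> i e)"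
    proof (rule sum_mono)
      fix i assume i: "i \<in> I"
      have "p' i * \<delta> i u \<ge> 0" "p i * \<delta> i u' \<ge> 0" using p[OF i] p'[OF i] by auto
      then show "p' i * \<delta> i e \<le> p i * \<delta> i e"
        using p[OF i] p'[OF i] unfolding \<delta>e[OF insertI2[OF i]] right_diff_distrib by linarith
    qed
    ultimately have "q * \<delta> j e > 0" using u[OF eW] by simp
    moreover have "\<delta> j e > 0" using \<delta>e[of j] u'W(2) False by simp
    ultimately have q: "q > 0" by (simp add: zero_less_mult_iff)
    have "(\<Sum>i\<in>insert j I. (p'(j := q)) i * \<delta> i v) = q * \<delta> j v + (\<Sum>i\<in>I. p' i * \<delta> i v)" for v
    proof -
      have "(\<Sum>i\<in>I. (p'(j := q)) i * \<delta> i v) = (\<Sum>i\<in>I. p' i * \<delta> i v)"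
        using insert.hyps(2) by (intro sum.cong) auto
      then show ?thesis using insert.hyps by simp
    qed
    then have "\<forall>v\<in>W. a u' v = L v + (\<Sum>i\<in>insert j I. (p'(j := q)) i * \<delta> i v)"
      using R_eq by (simp add: R_def algebra_simps)
    moreover have "\<forall>i\<in>insert j I. (p'(j := q)) i \<ge> 0 \<and> \<delta> i u' \<ge> 0 \<and> (p'(j := q)) i * \<delta> i u' = 0"
      using p' q u'W(2) by simp
    ultimately show ?thesis using u'W(1) by blast
  qed
qed

section \<open>Surface integrals of affine functions\<close>

text \<open>For a bounded neighbourhood \<open>B\<close> of \<open>0\<close> that is invariant under \<open>L\<close> and \<open>- L\<close>, translation invariance and
  Fubini give \<open>\<lambda>(L\<inverse> A) \<lambda>(B) = \<lambda>(A) \<lambda>(B)\<close>. The change of variables theorems of the library need an ordered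
  index type.\<close>

lemma lborel_distr_linear_involution:
  fixes L :: "'a::euclidean_space \<Rightarrow> 'a"
  assumes L: "linear L" and inv: "\<And>x. L (L x) = x"
  shows "distr lborel borel L = lborel"
proof (rule measure_eqI)
  show "sets (distr lborel borel L) = sets lborel" by simp
  fix A assume "A \<in> sets (distr lborel borel L)"
  then have A[measurable]: "A \<in> sets borel" by simp
  have Lm[measurable]: "L \<in> borel_measurable borel"
    using L by (intro borel_measurable_continuous_onI linear_continuous_on) (simp add: linear_conv_bounded_linear)
  \<comment> \<open>The unit ball made invariant under \<open>L\<close>. Its measure is cancelled at
    the end and therefore has to be both finite and positive.\<close>
  define B where "B = {x. norm x \<le> 1 \<and> norm (L x) \<le> 1}"
  have B[measurable]: "B \<in> sets borel" unfolding B_def by measurable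
  have trans: "(\<integral>\<^sup>+x. f (x + c) \<partial>lborel) = (\<integral>\<^sup>+x. f x \<partial>lborel)"
    if [measurable]: "f \<in> borel_measurable borel" for f :: "'a \<Rightarrow> ennreal" and c
  proof -
    have "(\<integral>\<^sup>+x. f x \<partial>lborel) = (\<integral>\<^sup>+x. f x \<partial>distr lborel borel ((+) c))"
      by (subst lborel_distr_plus) simp
    also have "\<dots> = (\<integral>\<^sup>+x. f (x + c) \<partial>lborel)"
      by (subst nn_integral_distr) (auto simp: add.commute)
    finally show ?thesis by simp
  qed
  have fin: "emeasure lborel B < \<infinity>"
  proof -
    have "B \<subseteq> cball 0 1" by (auto simp: B_def)
    then have "emeasure lborel B \<le> emeasure lborel (cball 0 1 :: 'a set)" by (intro emeasure_mono) auto
    also have "\<dots> < \<infinity>" using emeasure_lborel_cball_finite by (auto simp: less_top)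
    finally show ?thesis .
  qed
  have pos: "emeasure lborel B \<noteq> 0"
  proof -
    have "open {x. norm x < 1 \<and> norm (L x) < 1}"
      using L by (intro open_Collect_conj open_Collect_less continuous_intros linear_continuous_on)
        (simp add: linear_conv_bounded_linear)
    moreover have "0 \<in> {x. norm x < 1 \<and> norm (L x) < 1}" using linear_0[OF L] by simp
    ultimately have "emeasure lborel {x. norm x < 1 \<and> norm (L x) < 1} \<noteq> 0"
      using open_not_negligible[of "{x. norm x < 1 \<and> norm (L x) < 1}"]
        null_sets_completionI[OF null_setsI, of lborel "{x. norm x < 1 \<and> norm (L x) < 1}"]
      unfolding negligible_iff_null_sets by fastforce
    moreover have "emeasure lborel {x. norm x < 1 \<and> norm (L x) < 1} \<le> emeasure lborel B"
      by (intro emeasure_mono) (auto simp: B_def)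
    ultimately show ?thesis by auto
  qed
  let ?M = "\<lambda>A. emeasure lborel (L -` A)"
  have "?M A * emeasure lborel B = (\<integral>\<^sup>+y. (\<integral>\<^sup>+x. indicator A (L x) * indicator B y \<partial>lborel) \<partial>lborel)"
  proof -
    have "?M A = (\<integral>\<^sup>+x. indicator A (L x) \<partial>lborel)"
      using measurable_sets[OF Lm A]
      by (simp add: indicator_vimage[symmetric] comp_def flip: nn_integral_indicator)
    then show ?thesis by (simp add: nn_integral_multc nn_integral_cmult)
  qed
  \<comment> \<open>Translating \<open>x\<close> by \<open>L y\<close> adds \<open>y\<close> to
    \<open>L x\<close>, because \<open>L\<close> is an involution.\<close>
  also have "\<dots> = (\<integral>\<^sup>+y. (\<integral>\<^sup>+x. indicator A (L x + y) * indicator B y \<partial>lborel) \<partial>lborel)"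
  proof (rule nn_integral_cong)
    fix y :: 'a
    show "(\<integral>\<^sup>+x. indicator A (L x) * indicator B y \<partial>lborel) = (\<integral>\<^sup>+x. indicator A (L x + y) * indicator B y \<partial>lborel)"
      using trans[of "\<lambda>x. indicator A (L x) * indicator B y" "L y"] by (simp add: linear_add[OF L] inv)
  qed
  also have "\<dots> = (\<integral>\<^sup>+x. (\<integral>\<^sup>+y. indicator A (L x + y) * indicator B y \<partial>lborel) \<partial>lborel)"
    by (rule lborel_pair.Fubini') measurable
  also have "\<dots> = (\<integral>\<^sup>+x. (\<integral>\<^sup>+y. indicator A y * indicator B (y - L x) \<partial>lborel) \<partial>lborel)"
  proof (rule nn_integral_cong)
    fix x :: 'a
    show "(\<integral>\<^sup>+y. indicator A (L x + y) * indicator B y \<partial>lborel) = (\<integral>\<^sup>+y. indicator A y * indicator B (y - L x) \<partial>lborel)"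
      using trans[of "\<lambda>y. indicator A y * indicator B (y - L x)" "L x"] by (simp add: add.commute)
  qed
  also have "\<dots> = (\<integral>\<^sup>+y. (\<integral>\<^sup>+x. indicator A y * indicator B (y - L x) \<partial>lborel) \<partial>lborel)"
    by (rule lborel_pair.Fubini') measurable
  also have "\<dots> = (\<integral>\<^sup>+y. indicator A y * emeasure lborel B \<partial>lborel)"
  proof (rule nn_integral_cong)
    fix y :: 'a
    \<comment> \<open>Applying \<open>L\<close> to \<open>y - L x\<close> gives
      \<open>L y - x\<close>, so the two norm conditions defining \<open>B\<close> merely change
      places.\<close>
    have "y - L x \<in> B \<longleftrightarrow> x + - L y \<in> B" for x
      by (simp add: B_def linear_diff[OF L] inv norm_minus_commute conj_commute)
    then have "(\<integral>\<^sup>+x. indicator B (y - L x) \<partial>lborel) = (\<integral>\<^sup>+x. indicator B (x + - L y) \<partial>lborel)"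
      by (intro nn_integral_cong) (simp add: indicator_def)
    also have "\<dots> = emeasure lborel B" by (subst trans) auto
    finally show "(\<integral>\<^sup>+x. indicator A y * indicator B (y - L x) \<partial>lborel) = indicator A y * emeasure lborel B"
      by (simp add: nn_integral_cmult)
  qed
  also have "\<dots> = emeasure lborel A * emeasure lborel B" by (simp add: nn_integral_multc)
  finally have "emeasure lborel B * ?M A = emeasure lborel B * emeasure lborel A" by (simp only: mult.commute)
  then have "?M A = emeasure lborel A"
    using fin pos by (auto simp: ennreal_mult_cancel_left)
  then show "emeasure (distr lborel borel L) A = emeasure lborel A" by (simp add: emeasure_distr)
qed

section \<open>Affine functions determined by vertex values\<close>

lemma affine_interpolation:
  fixes C :: "'a::euclidean_space set" and r :: "'a \<Rightarrow> 'b::real_vector"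
  assumes "\<not> affine_dependent C"
  obtains f b where "linear f" "\<And>v. v \<in> C \<Longrightarrow> f v + b = r v"
proof (cases "C = {}")
  case True
  then show ?thesis using that[of "\<lambda>_. 0" 0] by (auto simp: linear_iff)
next
  case False
  then obtain c where c: "c \<in> C" by auto
  \<comment> \<open>Moving the vertex \<open>c\<close> to the origin turns affine independence into
    linear independence; the constant term then absorbs the value at \<open>c\<close>.\<close>
  have "independent ((\<lambda>x. - c + x) ` (C - {c}))"
    using assms affine_dependent_iff_dependent2[OF c] by simp
  then obtain f where f: "linear f" "\<forall>y\<in>(\<lambda>x. - c + x) ` (C - {c}). f y = r (c + y) - r c"
    using linear_independent_extend[of "(\<lambda>x. - c + x) ` (C - {c})" "\<lambda>y. r (c + y) - r c"] by blast
  have "f v + (r c - f c) = r v" if "v \<in> C" for v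
  proof (cases "v = c")
    case False
    then have "f (- c + v) = r v - r c" using f(2) that by auto
    then show ?thesis using linear_diff[OF f(1), of v c] by (simp add: algebra_simps)
  qed simp
  then show ?thesis using that f(1) by blast
qed

text \<open>The coordinates are kept as affine functions on the whole space, since they are also
  evaluated at points outside the simplex and off the hyperplane of a facet.\<close>

lemma barycentric_coordinates:
  fixes C :: "'a::euclidean_space set"
  assumes "\<not> affine_dependent C"
  obtains g :: "'a \<Rightarrow> 'a \<Rightarrow> real" and b where
    "\<And>v. linear (g v)" "\<And>v u. v \<in> C \<Longrightarrow> u \<in> C \<Longrightarrow> g v u + b v = (if u = v then 1 else 0)"
proof -
  have "\<exists>f b. linear f \<and> (\<forall>u\<in>C. f u + b = (if u = v then 1 else 0 :: real))" for v
    using affine_interpolation[OF assms, of "\<lambda>u. if u = v then 1 else 0"] by metis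
  then show ?thesis using that by metis
qed

lemma affine_eq_on_convex_hull:
  assumes "linear f" "linear g" "\<And>v. v \<in> C \<Longrightarrow> f v + b = g v + d" "x \<in> convex hull C"
  shows "f x + b = g x + d"
proof -
  have "convex {x. f x + b = g x + d}"
  proof (rule convexI)
    fix x y and u v :: real
    assume *: "x \<in> {x. f x + b = g x + d}" "y \<in> {x. f x + b = g x + d}" "u + v = 1"
    have "f (u *\<^sub>R x + v *\<^sub>R y) + b = u *\<^sub>R (f x + b) + v *\<^sub>R (f y + b)"
      using *(3) scaleR_left_distrib[of u v b, symmetric]
      by (simp add: linear_add linear_scale assms(1) algebra_simps)
    also have "\<dots> = u *\<^sub>R (g x + d) + v *\<^sub>R (g y + d)" using * by simp
    also have "\<dots> = g (u *\<^sub>R x + v *\<^sub>R y) + d"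
      using *(3) scaleR_left_distrib[of u v d, symmetric]
      by (simp add: linear_add linear_scale assms(2) algebra_simps)
    finally show "u *\<^sub>R x + v *\<^sub>R y \<in> {x. f x + b = g x + d}" by simp
  qed
  then have "convex hull C \<subseteq> {x. f x + b = g x + d}"
    using assms(3) by (intro hull_minimal) auto
  then show ?thesis using assms(4) by auto
qed

text \<open>Collects what the surface measure relies on: compactness makes it finite, nonemptiness
  provides the base point of \<open>face_proj\<close>, and the last condition guarantees that the
  choice in \<open>face_unit_normal\<close> succeeds.\<close>

definition flat_piece :: "'a::euclidean_space set \<Rightarrow> bool" where
  "flat_piece F \<longleftrightarrow> compact F \<and> F \<noteq> {} \<and> (\<exists>\<nu>. norm \<nu> = 1 \<and> (\<forall>x\<in>F. \<forall>y\<in>F. \<nu> \<bullet> (x - y) = 0))"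

lemma face_unit_normal:
  assumes "flat_piece F"
  shows "norm (face_unit_normal F) = 1"
    and "x \<in> F \<Longrightarrow> y \<in> F \<Longrightarrow> face_unit_normal F \<bullet> (x - y) = 0"
proof -
  have "\<exists>\<nu>. norm \<nu> = 1 \<and> (\<forall>x\<in>F. \<forall>y\<in>F. \<nu> \<bullet> (x - y) = 0)"
    using assms by (simp only: flat_piece_def)
  then have "norm (face_unit_normal F) = 1 \<and> (\<forall>x\<in>F. \<forall>y\<in>F. face_unit_normal F \<bullet> (x - y) = 0)"
    unfolding face_unit_normal_def by (rule someI_ex)
  then show "norm (face_unit_normal F) = 1" "x \<in> F \<Longrightarrow> y \<in> F \<Longrightarrow> face_unit_normal F \<bullet> (x - y) = 0"
    by blast+
qed

text \<open>All points of \<open>F\<close> have the same normal component, so the arbitrary base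
  point inside \<open>face_proj\<close> has no influence.\<close>

lemma face_proj_prism:
  assumes "flat_piece F" "x \<in> F"
  shows "face_proj F (x + s *\<^sub>R face_unit_normal F) = x"
proof -
  let ?\<nu> = "face_unit_normal F" and ?a = "SOME a. a \<in> F"
  have "?a \<in> F" using assms(2) by (metis someI)
  then have "?\<nu> \<bullet> (x - ?a) = 0" using face_unit_normal assms by blast
  moreover have "?\<nu> \<bullet> ?\<nu> = 1" using face_unit_normal(1)[OF assms(1)] by (simp add: dot_square_norm)
  ultimately show ?thesis
    by (simp add: face_proj_def inner_add_left inner_add_right inner_diff_left inner_diff_right inner_commute)
qed

lemma face_proj_measurable [measurable]: "face_proj F \<in> borel_measurable borel"
  unfolding face_proj_def[abs_def]
  by (intro borel_measurable_continuous_onI continuous_intros)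

lemma compact_face_prism:
  assumes "flat_piece F"
  shows "compact (face_prism F)"
proof -
  have "face_prism F = (\<lambda>(x, s). x + s *\<^sub>R face_unit_normal F) ` (F \<times> {0..1})"
    by (force simp: face_prism_def)
  moreover have "compact (F \<times> {0..1::real})"
    using assms by (intro compact_Times) (auto simp: flat_piece_def)
  ultimately show ?thesis
    by (simp add: case_prod_unfold compact_continuous_image continuous_intros)
qed

lemma face_prism_borel: "flat_piece F \<Longrightarrow> face_prism F \<in> sets borel"
  by (simp add: borel_compact compact_face_prism)

section \<open>Integration against the surface measure\<close>

lemma space_face_measure [simp]: "space (face_measure F) = UNIV"
  and sets_face_measure [simp, measurable_cong]: "sets (face_measure F) = sets borel"
  by (auto simp: face_measure_def)

lemma measurable_face_measure [simp]:
  "h \<in> measurable (face_measure F) M \<longleftrightarrow> h \<in> measurable borel M"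
  using measurable_cong_sets[of "face_measure F" borel M M] by simp

lemma emeasure_face_measure:
  assumes "flat_piece F" "A \<in> sets borel"
  shows "emeasure (face_measure F) A = emeasure lborel (face_proj F -` A \<inter> face_prism F)"
proof -
  have *: "face_proj F -` A \<in> sets borel"
    using measurable_sets[OF face_proj_measurable assms(2)] by simp
  show ?thesis
    unfolding face_measure_def using assms face_prism_borel[OF assms(1)] *
    by (subst emeasure_distr)
      (auto intro!: measurable_restrict_space1 emeasure_restrict_space simp: space_restrict_space
        emeasure_restrict_space)
qed

lemma finite_face_measure:
  assumes "flat_piece F"
  shows "finite_measure (face_measure F)"
proof
  have "emeasure lborel (face_prism F) < \<infinity>"
    using emeasure_bounded_finite compact_face_prism[OF assms] compact_imp_bounded by blast
  then show "emeasure (face_measure F) (space (face_measure F)) \<noteq> \<infinity>"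
    using emeasure_face_measure[OF assms, of UNIV] by auto
qed

text \<open>The projection sends the whole prism into \<open>F\<close>. As
  \<open>face_measure F\<close> is a measure on the whole space, identities valid only on the face
  enter integrals through this lemma.\<close>

lemma AE_face_measure:
  assumes "flat_piece F"
  shows "AE x in face_measure F. x \<in> F"
proof (rule AE_I)
  have "F \<in> sets borel" using assms by (auto simp: flat_piece_def intro: borel_compact)
  then show "- F \<in> sets (face_measure F)" by auto
  have "face_proj F -` (- F) \<inter> face_prism F = {}"
    using face_proj_prism[OF assms] by (auto simp: face_prism_def)
  then show "emeasure (face_measure F) (- F) = 0"
    using emeasure_face_measure[OF assms, of "- F"] \<open>F \<in> sets borel\<close> by auto
qed auto

lemma face_area_eq:
  assumes "flat_piece F"
  shows "face_area F = measure (face_measure F) UNIV"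
proof -
  interpret finite_measure "face_measure F" by (rule finite_face_measure[OF assms])
  have "F \<in> sets borel" using assms by (auto simp: flat_piece_def intro: borel_compact)
  then show ?thesis unfolding face_area_def
    using AE_face_measure[OF assms] by (intro finite_measure_eq_AE) auto
qed

lemma integrable_face_measure_bounded:
  fixes h :: "'a::euclidean_space \<Rightarrow> 'b::{banach, second_countable_topology}"
  assumes "flat_piece F" "h \<in> borel_measurable borel" "\<And>x. norm (h x) \<le> B"
  shows "integrable (face_measure F) h"
proof -
  interpret finite_measure "face_measure F" by (rule finite_face_measure[OF assms(1)])
  show ?thesis using assms by (intro integrable_const_bound[of _ B]) auto
qed

lemma integrable_face_measure_continuous:
  fixes h :: "'a::euclidean_space \<Rightarrow> 'b::{banach, second_countable_topology}"
  assumes F: "flat_piece F" and h: "continuous_on UNIV h"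
  shows "integrable (face_measure F) h"
proof -
  interpret finite_measure "face_measure F" by (rule finite_face_measure[OF F])
  have "compact (h ` F)" using F h
    by (meson compact_continuous_image continuous_on_subset flat_piece_def subset_UNIV)
  then obtain B where B: "\<And>x. x \<in> F \<Longrightarrow> norm (h x) \<le> B"
    by (meson bounded_iff compact_imp_bounded imageI)
  have "h \<in> borel_measurable (face_measure F)"
    using borel_measurable_continuous_onI[OF h] by simp
  then show ?thesis
    using AE_face_measure[OF F] B by (intro integrable_const_bound[of _ B]) auto
qed

lemma integral_face_measure:
  fixes h :: "'a::euclidean_space \<Rightarrow> 'b::{banach, second_countable_topology}"
  assumes "flat_piece F" and h[measurable]: "h \<in> borel_measurable borel"
  shows "(LINT x|face_measure F. h x) = (LINT z|lborel. indicator (face_prism F) z *\<^sub>R h (face_proj F z))"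
  unfolding face_measure_def using face_prism_borel[OF assms(1)]
  by (subst integral_distr) (auto simp: integral_restrict_space intro!: measurable_restrict_space1)

text \<open>The reflection that swaps \<open>i\<close> and \<open>j\<close>, fixes the other vertices and the normal direction
  preserves the prism and Lebesgue measure, and changes the sign of the integrand.\<close>

lemma integral_face_antisymmetric:
  fixes C :: "'a::euclidean_space set" and g :: "'a \<Rightarrow> real"
  assumes F: "flat_piece (convex hull C)" and ij: "i \<in> C" "j \<in> C" "i \<noteq> j" and g: "linear g"
    and gi: "g i + b = 1" and gj: "g j + b = - 1" and gv: "\<And>v. v \<in> C \<Longrightarrow> v \<noteq> i \<Longrightarrow> v \<noteq> j \<Longrightarrow> g v + b = 0"
  shows "(LINT x|face_measure (convex hull C). g x + b) = 0"
proof -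
  define F where "F = convex hull C"
  define \<nu> where "\<nu> = face_unit_normal F"
  define a where "a = (SOME a. a \<in> F)"
  have flat: "flat_piece F" using F by (simp add: F_def)
  have CF: "C \<subseteq> F" by (simp add: F_def hull_subset)
  have \<nu>\<nu>: "\<nu> \<bullet> \<nu> = 1" using face_unit_normal(1)[OF flat] by (simp add: \<nu>_def dot_square_norm)
  define d where "d = i - j"
  have \<nu>d: "d \<bullet> \<nu> = 0"
    using face_unit_normal(2)[OF flat, of i j] CF ij by (auto simp: d_def \<nu>_def inner_commute)
  \<comment> \<open>\<open>q\<close> extends \<open>g + b\<close> from the face so as to be constant
    along the normal; \<open>m\<close> is its linear part and \<open>\<kappa>\<close> its
    constant.\<close>
  define m where "m z = g (z - (z \<bullet> \<nu>) *\<^sub>R \<nu>)" for z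
  define q where "q z = g (face_proj F z) + b" for z
  define \<kappa> where "\<kappa> = g ((a \<bullet> \<nu>) *\<^sub>R \<nu>) + b"
  have proj: "face_proj F z = (z - (z \<bullet> \<nu>) *\<^sub>R \<nu>) + (a \<bullet> \<nu>) *\<^sub>R \<nu>" for z
    by (simp add: face_proj_def a_def \<nu>_def inner_diff_left algebra_simps)
  have q: "q z = m z + \<kappa>" for z
    unfolding q_def proj m_def \<kappa>_def by (simp add: linear_add[OF g])
  have m: "linear m"
    by (rule linearI) (simp_all add: m_def linear_add[OF g] linear_diff[OF g] linear_scale[OF g] inner_add_left algebra_simps)
  have md: "m d = 2" using gi gj by (simp add: m_def \<nu>d) (simp add: d_def linear_diff[OF g])
  have m\<nu>: "m \<nu> = 0" using \<nu>\<nu> linear_0[OF g] by (simp add: m_def)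
  \<comment> \<open>\<open>S\<close> is the reflection and \<open>L\<close> its linear part. As
    \<open>q\<close> is 1 at \<open>i\<close>, -1 at \<open>j\<close> and 0 at the other vertices,
    subtracting \<open>q z\<close> times \<open>d = i - j\<close> exchanges \<open>i\<close> and
    \<open>j\<close>. The value \<open>m d = 2\<close> makes \<open>L\<close> an involution and
    reverses the sign of \<open>q\<close> under \<open>S\<close>.\<close>
  define L where "L z = z - m z *\<^sub>R d" for z
  define S where "S z = z - q z *\<^sub>R d" for z
  have L: "linear L"
    by (rule linearI) (simp_all add: L_def linear_add[OF m] linear_scale[OF m] algebra_simps)
  have LL: "L (L z) = z" for z
    by (simp add: L_def linear_diff[OF m] linear_scale[OF m] md algebra_simps)
  have S_L: "S z = - (\<kappa> *\<^sub>R d) + L z" for z by (simp add: S_def L_def q algebra_simps)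
  have [measurable]: "L \<in> borel_measurable borel"
    using L by (intro borel_measurable_continuous_onI linear_continuous_on) (simp add: linear_conv_bounded_linear)
  have distr_S: "distr lborel borel S = lborel"
  proof -
    have "distr lborel borel S = distr (distr lborel borel L) borel ((+) (- (\<kappa> *\<^sub>R d)))"
      by (subst distr_distr) (auto simp: comp_def S_L[abs_def])
    then show ?thesis
      unfolding lborel_distr_linear_involution[OF L LL] lborel_distr_plus .
  qed
  have S[measurable]: "S \<in> borel_measurable borel" unfolding S_L[abs_def] by measurable
  have qS: "q (S z) = - q z" for z
    by (simp add: S_def q linear_diff[OF m] linear_scale[OF m] md)
  have SS: "S (S z) = z" for z using qS[of z] by (simp add: S_def[of "S z"]) (simp add: S_def)
  have q_eq: "q x = g x + b" if "x \<in> F" for x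
    using face_proj_prism[OF flat that, of 0] by (simp add: q_def)
  have SF: "S x \<in> F" if "x \<in> F" for x
  proof -
    have "convex {x. S x \<in> F}"
    proof (rule convexI)
      fix x y and u v :: real
      assume *: "x \<in> {x. S x \<in> F}" "y \<in> {x. S x \<in> F}" "0 \<le> u" "0 \<le> v" "u + v = 1"
      have "S (u *\<^sub>R x + v *\<^sub>R y) = u *\<^sub>R S x + v *\<^sub>R S y"
        using *(5) scaleR_left_distrib[of u v "\<kappa> *\<^sub>R d", symmetric]
        by (simp add: S_L linear_add[OF L] linear_scale[OF L] algebra_simps)
      moreover have "u *\<^sub>R S x + v *\<^sub>R S y \<in> F"
        using * convex_convex_hull[of C] by (simp add: F_def convex_def)
      ultimately show "u *\<^sub>R x + v *\<^sub>R y \<in> {x. S x \<in> F}" by simp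
    qed
    moreover have "S v \<in> C" if "v \<in> C" for v
      using that ij gi gj gv[OF that] q_eq[of v] CF by (cases "v = i"; cases "v = j") (auto simp: S_def d_def)
    ultimately have "convex hull C \<subseteq> {x. S x \<in> F}"
      using CF by (intro hull_minimal) auto
    then show ?thesis using that by (auto simp: F_def)
  qed
  have SP: "S z \<in> face_prism F" if "z \<in> face_prism F" for z
  proof -
    from that obtain x s where z: "z = x + s *\<^sub>R \<nu>" "x \<in> F" "0 \<le> s" "s \<le> 1"
      by (auto simp: face_prism_def \<nu>_def)
    have "S z = S x + s *\<^sub>R \<nu>"
      by (simp add: z(1) S_def q linear_add[OF m] linear_scale[OF m] m\<nu>)
    then show ?thesis using z SF by (auto simp: face_prism_def \<nu>_def)
  qed
  have ind: "indicator (face_prism F) (S z) = (indicator (face_prism F) z :: real)" for z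
    using SP[of z] SP[of "S z"] SS[of z] by (auto simp: indicator_def)
  have [measurable]: "face_prism F \<in> sets borel" by (rule face_prism_borel[OF flat])
  have gm: "g \<in> borel_measurable borel"
    using g by (intro borel_measurable_continuous_onI linear_continuous_on) (simp add: linear_conv_bounded_linear)
  then have [measurable]: "q \<in> borel_measurable borel" unfolding q_def[abs_def] by measurable
  let ?I = "LINT z|lborel. indicator (face_prism F) z *\<^sub>R q z"
  have "?I = (LINT z|distr lborel borel S. indicator (face_prism F) z *\<^sub>R q z)"
    by (simp add: distr_S)
  also have "\<dots> = (LINT z|lborel. indicator (face_prism F) (S z) *\<^sub>R q (S z))"
    by (rule integral_distr) auto
  also have "\<dots> = - ?I" by (simp add: ind qS)
  finally have "?I = 0" by simp
  moreover have "(LINT x|face_measure F. g x + b) = ?I"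
    using integral_face_measure[OF flat, of "\<lambda>x. g x + b"] gm by (simp add: q_def)
  ultimately show ?thesis by (simp add: F_def)
qed

text \<open>The difference of two barycentric coordinates is antisymmetric, so all coordinates have
  the same integral. They add up to 1 on the face, hence each integrates to the area divided by the
  number of vertices. Expanding \<open>f + b\<close> in them gives the formula.\<close>

lemma integral_face_affine:
  fixes C :: "'a::euclidean_space set" and f :: "'a \<Rightarrow> 'b::euclidean_space"
  assumes C: "\<not> affine_dependent C" and F: "flat_piece (convex hull C)" and f: "linear f"
  shows "(LINT x|face_measure (convex hull C). f x + b) =
    (face_area (convex hull C) / card C) *\<^sub>R (\<Sum>v\<in>C. f v + b)"
proof -
  define F where "F = convex hull C"
  note flat = F[folded F_def]
  have fin: "finite C" using C by (rule aff_independent_finite)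
  have ne: "C \<noteq> {}" using F by (auto simp: flat_piece_def)
  obtain g :: "'a \<Rightarrow> 'a \<Rightarrow> real" and \<beta> where g: "\<And>v. linear (g v)"
    and gC: "\<And>v u. v \<in> C \<Longrightarrow> u \<in> C \<Longrightarrow> g v u + \<beta> v = (if u = v then 1 else 0)"
    using barycentric_coordinates[OF C] by metis
  have cont: "continuous_on UNIV (\<lambda>x. g v x + \<beta> v)" for v
    using g[of v] by (intro continuous_intros linear_continuous_on) (simp add: linear_conv_bounded_linear)
  have int: "integrable (face_measure F) (\<lambda>x. g v x + \<beta> v)" for v
    by (rule integrable_face_measure_continuous[OF flat cont])
  have sum_eq: "(\<Sum>v\<in>C. (g v u + \<beta> v) *\<^sub>R r v) = r u" if "u \<in> C" for u and r :: "'a \<Rightarrow> 'c::real_vector"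
  proof -
    have "(\<Sum>v\<in>C. (g v u + \<beta> v) *\<^sub>R r v) = (\<Sum>v\<in>C. if v = u then r v else 0)"
      using gC that by (intro sum.cong) auto
    then show ?thesis using fin that by simp
  qed
  have expand: "(\<Sum>v\<in>C. (g v x + \<beta> v) *\<^sub>R (h v + c)) = h x + c"
    if "linear h" "x \<in> F" for x c and h :: "'a \<Rightarrow> 'c::real_vector"
  proof -
    have lin: "linear (\<lambda>x. \<Sum>v\<in>C. g v x *\<^sub>R (h v + c))"
      by (rule linearI)
        (simp_all add: linear_add[OF g] linear_scale[OF g] scaleR_left_distrib sum.distrib scaleR_sum_right)
    have "(\<Sum>v\<in>C. g v x *\<^sub>R (h v + c)) + (\<Sum>v\<in>C. \<beta> v *\<^sub>R (h v + c)) = h x + c"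
    proof (rule affine_eq_on_convex_hull[OF lin that(1)])
      show "x \<in> convex hull C" using that(2) by (simp add: F_def)
      fix u assume "u \<in> C"
      then show "(\<Sum>v\<in>C. g v u *\<^sub>R (h v + c)) + (\<Sum>v\<in>C. \<beta> v *\<^sub>R (h v + c)) = h u + c"
        using sum_eq[of u "\<lambda>v. h v + c"] by (simp add: scaleR_left_distrib sum.distrib)
    qed
    then show ?thesis by (simp add: scaleR_left_distrib sum.distrib)
  qed
  define I where "I v = (LINT x|face_measure F. g v x + \<beta> v)" for v
  have I_eq: "I i = I j" if ij: "i \<in> C" "j \<in> C" for i j
  proof (cases "i = j")
    case False
    have "linear (\<lambda>x. g i x - g j x)" using g by (intro linear_compose_sub) auto
    then have "(LINT x|face_measure F. (g i x - g j x) + (\<beta> i - \<beta> j)) = 0"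
      unfolding F_def using gC[OF ij(1)] gC[OF ij(2)] ij False
      by (intro integral_face_antisymmetric[OF F ij False]) (fastforce simp: algebra_simps)+
    moreover have "(LINT x|face_measure F. (g i x - g j x) + (\<beta> i - \<beta> j)) = I i - I j"
      unfolding I_def by (subst Bochner_Integration.integral_diff[OF int int, symmetric])
        (simp add: algebra_simps)
    ultimately show ?thesis by simp
  qed simp
  have "(\<Sum>v\<in>C. I v) = (LINT x|face_measure F. (\<Sum>v\<in>C. (g v x + \<beta> v)))"
    unfolding I_def using int by (simp add: Bochner_Integration.integral_sum)
  also have "\<dots> = (LINT x|face_measure F. 1)"
  proof (rule integral_cong_AE)
    show "AE x in face_measure F. (\<Sum>v\<in>C. g v x + \<beta> v) = 1"
      using AE_face_measure[OF flat]
    proof eventually_elim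
      case (elim x)
      have "linear (\<lambda>_::'a. 0::real)" by (simp add: linear_iff)
      from expand[OF this elim, of 1] show ?case by simp
    qed
  qed (use int in auto)
  also have "\<dots> = face_area F" by (simp add: face_area_eq[OF flat])
  finally have sumI: "(\<Sum>v\<in>C. I v) = face_area F" .
  have I: "I v = face_area F / card C" if "v \<in> C" for v
  proof -
    have "(\<Sum>u\<in>C. I u) = (\<Sum>u\<in>C. I v)" using I_eq that by (intro sum.cong refl) blast
    then show ?thesis using sumI fin ne by (simp add: field_simps)
  qed
  have "(LINT x|face_measure F. f x + b) = (LINT x|face_measure F. (\<Sum>v\<in>C. (g v x + \<beta> v) *\<^sub>R (f v + b)))"
  proof (rule integral_cong_AE)
    show "AE x in face_measure F. f x + b = (\<Sum>v\<in>C. (g v x + \<beta> v) *\<^sub>R (f v + b))"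
      using AE_face_measure[OF flat] by eventually_elim (simp add: expand[OF f])
    have "continuous_on UNIV (\<lambda>x. f x + b)"
      using f by (intro continuous_intros linear_continuous_on) (simp add: linear_conv_bounded_linear)
    then show "(\<lambda>x. f x + b) \<in> borel_measurable (face_measure F)"
      using borel_measurable_integrable[OF integrable_face_measure_continuous[OF flat]] by blast
  qed (use int in auto)
  also have "\<dots> = (\<Sum>v\<in>C. I v *\<^sub>R (f v + b))"
    unfolding I_def using int by (simp add: Bochner_Integration.integral_sum)
  also have "\<dots> = (face_area F / card C) *\<^sub>R (\<Sum>v\<in>C. f v + b)"
    by (simp add: I scaleR_sum_right)
  finally show ?thesis by (simp add: F_def)
qed

section \<open>Simplices and Lipschitz boundaries\<close>

lemma full_simplexE:
  fixes T :: "'a::euclidean_space set"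
  assumes "int DIM('a) simplex T"
  obtains C where "finite C" "\<not> affine_dependent C" "card C = Suc DIM('a)" "T = convex hull C"
  using assms that unfolding simplex by force

lemma simplex_facetE:
  fixes C :: "'a::euclidean_space set"
  assumes "\<not> affine_dependent C" "F facet_of convex hull C"
  obtains c where "c \<in> C" "F = convex hull (C - {c})"
  using assms facet_of_convex_hull_affine_independent by blast

lemma interior_full_simplex_nonempty:
  fixes T :: "'a::euclidean_space set"
  assumes "int DIM('a) simplex T"
  shows "interior T \<noteq> {}"
proof -
  have "T \<noteq> {}" using assms aff_dim_simplex by fastforce
  then have "rel_interior T \<noteq> {}" using assms convex_simplex rel_interior_eq_empty by blast
  moreover have "aff_dim T = int DIM('a)" using assms by (rule aff_dim_simplex)
  ultimately show ?thesis by (simp add: interior_rel_interior_gen)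
qed

lemma flat_piece_facet:
  fixes T :: "'a::euclidean_space set"
  assumes T: "int DIM('a) simplex T" and F: "F facet_of T"
  shows "flat_piece F"
proof -
  obtain C where C: "finite C" "\<not> affine_dependent C" "T = convex hull C"
    using full_simplexE[OF T] by metis
  obtain c where "F = convex hull (C - {c})"
    using simplex_facetE[OF C(2)] F C(3) by metis
  then have "compact F" using C(1) by (simp add: finite_imp_compact_convex_hull)
  have "aff_dim F < int DIM('a)" using F aff_dim_simplex[OF T] by (simp add: facet_of_def)
  then obtain a b where a: "a \<noteq> 0" "F \<subseteq> {x. a \<bullet> x = b}" by (rule aff_lowdim_subset_hyperplane)
  have "norm (a /\<^sub>R norm a) = 1" using a by simp
  moreover have "(a /\<^sub>R norm a) \<bullet> (x - y) = 0" if "x \<in> F" "y \<in> F" for x y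
  proof -
    have "a \<bullet> x = b" "a \<bullet> y = b" using a that by auto
    then show ?thesis by (simp add: inner_diff_right)
  qed
  ultimately have "\<exists>\<nu>. norm \<nu> = 1 \<and> (\<forall>x\<in>F. \<forall>y\<in>F. \<nu> \<bullet> (x - y) = 0)" by blast
  then show ?thesis using \<open>compact F\<close> F by (simp add: flat_piece_def facet_of_def)
qed

text \<open>The integral over the facet opposite \<open>c\<close> is the area times the mean of the vertex values
  \<open>r v\<close>, \<open>v \<noteq> c\<close>. The conditions \<open>(\<Sum>v\<in>C - {c}. r v) = DIM('a) m\<^sub>c\<close> are solved by
  \<open>r c = (\<Sum>v\<in>C. m\<^sub>v) - DIM('a) m\<^sub>c\<close>.\<close>

lemma facet_mean_interpolation:
  fixes T :: "'a::euclidean_space set" and m :: "'a set \<Rightarrow> 'b::euclidean_space"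
  assumes T: "int DIM('a) simplex T"
  obtains f b where "linear f"
    "\<And>F. F facet_of T \<Longrightarrow> (LINT x|face_measure F. f x + b) = face_area F *\<^sub>R m F"
proof -
  obtain C where fin: "finite C" and C: "\<not> affine_dependent C" and card: "card C = Suc DIM('a)"
    and T_eq: "T = convex hull C"
    using full_simplexE[OF T] by metis
  define M where "M c = m (convex hull (C - {c}))" for c
  obtain f b where f: "linear f" and fb: "\<And>v. v \<in> C \<Longrightarrow> f v + b = (\<Sum>c\<in>C. M c) - real DIM('a) *\<^sub>R M v"
    using affine_interpolation[OF C, of "\<lambda>v. (\<Sum>c\<in>C. M c) - real DIM('a) *\<^sub>R M v"] by metis
  have "(LINT x|face_measure F. f x + b) = face_area F *\<^sub>R m F" if F: "F facet_of T" for F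
  proof -
    obtain c where c: "c \<in> C" "F = convex hull (C - {c})"
      using simplex_facetE[OF C] F T_eq by metis
    have ind: "\<not> affine_dependent (C - {c})" using C by (rule affine_independent_Diff)
    have card': "card (C - {c}) = DIM('a)" using card c fin by simp
    have "(\<Sum>v\<in>C - {c}. f v + b) = (\<Sum>v\<in>C - {c}. (\<Sum>c\<in>C. M c) - real DIM('a) *\<^sub>R M v)"
      using fb by (intro sum.cong) auto
    also have "\<dots> = real DIM('a) *\<^sub>R (\<Sum>c\<in>C. M c) - real DIM('a) *\<^sub>R (\<Sum>v\<in>C - {c}. M v)"
      by (simp add: sum_subtractf card' scaleR_sum_right sum_constant_scaleR)
    also have "\<dots> = real DIM('a) *\<^sub>R m F"
      using c fin by (simp add: sum.remove[of C c] M_def flip: scaleR_diff_right)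
    finally have sum_eq: "(\<Sum>v\<in>C - {c}. f v + b) = real DIM('a) *\<^sub>R m F" .
    have "flat_piece (convex hull (C - {c}))" using flat_piece_facet[OF T F] c by simp
    from integral_face_affine[OF ind this f, of b]
    show ?thesis using DIM_positive[where 'a = 'a] unfolding sum_eq card' by (simp add: c)
  qed
  then show ?thesis using that f by blast
qed

text \<open>Locally the simplex is a half space: near \<open>x\<close> all barycentric coordinates
  stay positive except the one of the vertex opposite the facet. That one vanishes at
  \<open>x\<close>, so at \<open>x + h\<close> it is linear in \<open>h\<close>, and
  \<open>\<alpha>\<close> is its gradient.\<close>

lemma simplex_near_facet:
  fixes T :: "'a::euclidean_space set"
  assumes T: "int DIM('a) simplex T" and F: "F facet_of T" and x: "x \<in> rel_interior F"
  obtains \<alpha> e where "e > 0"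
    "\<And>h. norm h < e \<Longrightarrow> \<alpha> \<bullet> h \<ge> 0 \<Longrightarrow> x + h \<in> T"
    "\<And>h. norm h < e \<Longrightarrow> \<alpha> \<bullet> h > 0 \<Longrightarrow> x + h \<in> interior T"
proof -
  obtain C where fin: "finite C" and C: "\<not> affine_dependent C" and card: "card C = Suc DIM('a)"
    and T_eq: "T = convex hull C"
    using full_simplexE[OF T] by metis
  obtain c where c: "c \<in> C" "F = convex hull (C - {c})"
    using simplex_facetE[OF C] F T_eq by metis
  obtain g :: "'a \<Rightarrow> 'a \<Rightarrow> real" and \<beta> where g: "\<And>v. linear (g v)"
    and gC: "\<And>v u. v \<in> C \<Longrightarrow> u \<in> C \<Longrightarrow> g v u + \<beta> v = (if u = v then 1 else 0)"
    using barycentric_coordinates[OF C] by metis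
  have bary: "g w (\<Sum>v\<in>C. k v *\<^sub>R v) + \<beta> w = k w" if k: "sum k C = 1" and w: "w \<in> C" for k w
  proof -
    have "g w (\<Sum>v\<in>C. k v *\<^sub>R v) + \<beta> w = (\<Sum>v\<in>C. k v * (g w v + \<beta> w))"
      using k by (simp add: linear_sum[OF g] linear_scale[OF g] distrib_left sum.distrib flip: sum_distrib_right)
    also have "\<dots> = (\<Sum>v\<in>C. if v = w then k v else 0)" using gC w by (intro sum.cong) auto
    finally show ?thesis using fin w by simp
  qed
  have inT: "y \<in> T" if y: "\<And>v. v \<in> C \<Longrightarrow> g v y + \<beta> v \<ge> 0" for y
  proof -
    \<comment> \<open>With one vertex more than the dimension the affine hull is the whole space, so
      every point has coordinates and membership in \<open>T\<close> is a matter of their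
      signs.\<close>
    have "y \<in> affine hull C" using affine_independent_span_eq[OF C card] by simp
    then obtain k where k: "sum k C = 1" "y = (\<Sum>v\<in>C. k v *\<^sub>R v)"
      using affine_hull_finite[OF fin] by auto
    have "k v \<ge> 0" if "v \<in> C" for v using y[OF that] bary[OF k(1) that] k(2) by simp
    then show ?thesis unfolding T_eq convex_hull_finite[OF fin] using k by auto
  qed
  have cont: "continuous_on UNIV (\<lambda>y. g v y + \<beta> v)" for v
    using g[of v] by (intro continuous_intros linear_continuous_on) (simp add: linear_conv_bounded_linear)
  have inI: "y \<in> interior T" if y: "\<And>v. v \<in> C \<Longrightarrow> g v y + \<beta> v > 0" for y
  proof -
    have "open (\<Inter>v\<in>C. {y. 0 < g v y + \<beta> v})"
      using fin cont by (intro open_INT ballI open_Collect_less) auto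
    moreover have "(\<Inter>v\<in>C. {y. 0 < g v y + \<beta> v}) \<subseteq> T" using inT by (auto intro: less_imp_le)
    moreover have "y \<in> (\<Inter>v\<in>C. {y. 0 < g v y + \<beta> v})" using y by blast
    ultimately show ?thesis by (metis (no_types, lifting) interiorI)
  qed
  obtain k where k: "\<And>v. v \<in> C - {c} \<Longrightarrow> k v > 0" "sum k (C - {c}) = 1" "x = (\<Sum>v\<in>C - {c}. k v *\<^sub>R v)"
    using x rel_interior_convex_hull_explicit[OF affine_independent_Diff[OF C, of "{c}"]] c(2) by auto
  define k' where "k' = k(c := 0)"
  have k': "sum k' C = 1" "x = (\<Sum>v\<in>C. k' v *\<^sub>R v)"
    using fin c(1) k(2,3) by (auto simp: k'_def sum.remove[of C c])
  have gx: "g v x + \<beta> v = k' v" if "v \<in> C" for v using bary[OF k'(1) that] k'(2) by simp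
  have "open (\<Inter>v\<in>C - {c}. {y. 0 < g v y + \<beta> v})"
    using fin cont by (intro open_INT ballI open_Collect_less) auto
  moreover have "x \<in> (\<Inter>v\<in>C - {c}. {y. 0 < g v y + \<beta> v})" 
  proof
    fix v assume v: "v \<in> C - {c}"
    then have "k' v = k v" by (simp add: k'_def)
    then have "g v x + \<beta> v > 0" using v gx[of v] k(1)[OF v] by simp
    then show "x \<in> {y. 0 < g v y + \<beta> v}" by simp
  qed
  ultimately obtain e where e: "e > 0" "ball x e \<subseteq> (\<Inter>v\<in>C - {c}. {y. 0 < g v y + \<beta> v})"
    unfolding open_contains_ball by (metis (no_types, lifting))
  define \<alpha> where "\<alpha> = adjoint (g c) 1"
  have \<alpha>: "\<alpha> \<bullet> h = g c h" for h using adjoint_works[OF g, of h c 1] by (simp add: \<alpha>_def inner_commute)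
  have gch: "g c (x + h) + \<beta> c = \<alpha> \<bullet> h" for h
    using gx[OF c(1)] by (simp add: \<alpha> linear_add[OF g] k'_def)
  have pos: "g v (x + h) + \<beta> v > 0" if "norm h < e" "v \<in> C" "v \<noteq> c" for v h
  proof -
    have "x + h \<in> ball x e" using that by (simp add: dist_norm)
    then show ?thesis using e(2) that by auto
  qed
  have "x + h \<in> T" if "norm h < e" "\<alpha> \<bullet> h \<ge> 0" for h
  proof (rule inT)
    fix v assume "v \<in> C"
    then show "g v (x + h) + \<beta> v \<ge> 0"
      using that gch[of h] pos[of h v] by (cases "v = c") auto
  qed
  moreover have "x + h \<in> interior T" if "norm h < e" "\<alpha> \<bullet> h > 0" for h
  proof (rule inI)
    fix v assume "v \<in> C"
    then show "g v (x + h) + \<beta> v > 0"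
      using that gch[of h] pos[of h v] by (cases "v = c") auto
  qed
  ultimately show ?thesis using that e(1) by blast
qed

text \<open>If both inner products were negative at \<open>h\<close>, both would be positive at
  \<open>- h\<close>.\<close>

lemma half_spaces_cover:
  fixes a b :: "'a::real_inner"
  assumes opp: "\<And>h. a \<bullet> h > 0 \<Longrightarrow> b \<bullet> h \<le> 0"
  shows "a \<bullet> h \<ge> 0 \<or> b \<bullet> h \<ge> 0"
proof (rule ccontr)
  assume "\<not> ?thesis"
  then have h: "a \<bullet> h < 0" "b \<bullet> h < 0" by auto
  then have "a \<bullet> (- h) > 0" by simp
  then have "b \<bullet> (- h) \<le> 0" by (rule opp)
  then show False using h by simp
qed

text \<open>Near \<open>x\<close> each simplex contains a half space bounded by a hyperplane through
  \<open>x\<close>. Disjointness of the interiors makes the half spaces opposite, so together they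
  fill a ball.\<close>

lemma shared_facet_interior:
  fixes T T' :: "'a::euclidean_space set"
  assumes T: "int DIM('a) simplex T" "F facet_of T" and T': "int DIM('a) simplex T'" "F facet_of T'"
    and disj: "interior T \<inter> interior T' = {}" and x: "x \<in> rel_interior F"
  shows "x \<in> interior (T \<union> T')"
proof -
  obtain \<alpha> e where e: "e > 0" and a: "\<And>h. norm h < e \<Longrightarrow> \<alpha> \<bullet> h \<ge> 0 \<Longrightarrow> x + h \<in> T"
    "\<And>h. norm h < e \<Longrightarrow> \<alpha> \<bullet> h > 0 \<Longrightarrow> x + h \<in> interior T"
    using simplex_near_facet[OF T x] by metis
  obtain \<alpha>' e' where e': "e' > 0" and a': "\<And>h. norm h < e' \<Longrightarrow> \<alpha>' \<bullet> h \<ge> 0 \<Longrightarrow> x + h \<in> T'"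
    "\<And>h. norm h < e' \<Longrightarrow> \<alpha>' \<bullet> h > 0 \<Longrightarrow> x + h \<in> interior T'"
    using simplex_near_facet[OF T' x] by metis
  have opp: "\<alpha>' \<bullet> h \<le> 0" if h: "\<alpha> \<bullet> h > 0" for h
  proof (rule ccontr)
    assume "\<not> \<alpha>' \<bullet> h \<le> 0"
    then have h': "\<alpha>' \<bullet> h > 0" by simp
    \<comment> \<open>The half space conditions are invariant under positive scaling, so
      \<open>h\<close> may be shrunk into both neighbourhoods; the summand 1 keeps the denominator
      positive.\<close>
    define t where "t = min e e' / (2 * (norm h + 1))"
    have t: "t > 0" using e e' by (simp add: t_def divide_pos_pos add_nonneg_pos)
    have "t * norm h < min e e'"
    proof -
      have "t * norm h \<le> t * (norm h + 1)" using t by simp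
      also have "\<dots> = min e e' / 2"
        unfolding t_def using norm_ge_zero[of h] by (simp add: add_nonneg_eq_0_iff field_simps)
      also have "\<dots> < min e e'" using e e' by (simp add: min_def)
      finally show ?thesis .
    qed
    then have "norm (t *\<^sub>R h) < e" "norm (t *\<^sub>R h) < e'" using t by auto
    then have "x + t *\<^sub>R h \<in> interior T \<inter> interior T'"
      using a(2)[of "t *\<^sub>R h"] a'(2)[of "t *\<^sub>R h"] t h h' by simp
    then show False using disj by blast
  qed
  have "ball x (min e e') \<subseteq> T \<union> T'"
  proof
    fix y assume "y \<in> ball x (min e e')"
    then have "norm (y - x) < e" "norm (y - x) < e'" by (auto simp: dist_norm norm_minus_commute)
    then show "y \<in> T \<union> T'"
      using half_spaces_cover[of \<alpha> \<alpha>' "y - x", OF opp] a(1)[of "y - x"] a'(1)[of "y - x"] by auto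
  qed
  then show ?thesis unfolding mem_interior using e e' by (intro exI[of _ "min e e'"]) simp
qed

text \<open>A frontier point lies on or below the graph. Strictly below the graph, and arbitrarily
  close to the point, there are open sets that miss the domain and hence its closure.\<close>

lemma lipschitz_domain_frontier:
  fixes \<Omega> :: "'a::euclidean_space set"
  assumes "lipschitz_domain \<Omega>" "open \<Omega>" "x \<in> frontier \<Omega>"
  shows "x \<notin> interior (closure \<Omega>)"
proof
  assume xi: "x \<in> interior (closure \<Omega>)"
  obtain U e \<phi> C where U: "open U" "x \<in> U" and e: "norm e = 1"
    and \<phi>: "C-lipschitz_on {z. z \<bullet> e = 0} \<phi>"
    and eq: "\<Omega> \<inter> U = {y \<in> U. \<phi> (y - (y \<bullet> e) *\<^sub>R e) < y \<bullet> e}"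
    using bspec[OF assms(1)[unfolded lipschitz_domain_def] assms(3)] by blast
  have ee: "e \<bullet> e = 1" using e by (simp add: dot_square_norm)
  define P where "P y = y - (y \<bullet> e) *\<^sub>R e" for y
  have P0: "P y \<bullet> e = 0" for y by (simp add: P_def inner_diff_left ee)
  have cont: "continuous_on UNIV (\<lambda>y. \<phi> (P y) - y \<bullet> e)"
  proof -
    have "continuous_on UNIV P" unfolding P_def[abs_def] by (intro continuous_intros)
    moreover have "continuous_on {z. z \<bullet> e = 0} \<phi>" using \<phi> by (rule lipschitz_on_continuous_on)
    ultimately have "continuous_on UNIV (\<lambda>y. \<phi> (P y))"
      using continuous_on_compose2[of "{z. z \<bullet> e = 0}" \<phi> UNIV P] P0 by (auto simp: subset_eq)
    then show ?thesis by (intro continuous_intros)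
  qed
  have "x \<notin> \<Omega>" using assms(2,3) by (simp add: frontier_def interior_open)
  then have "\<not> \<phi> (P x) < x \<bullet> e" using eq U(2) unfolding P_def by blast
  then have x: "\<phi> (P x) \<ge> x \<bullet> e" by simp
  obtain r where r: "r > 0" "ball x r \<subseteq> interior (closure \<Omega>) \<inter> U"
    using open_contains_ball_eq[of "interior (closure \<Omega>) \<inter> U" x] xi U by blast
  \<comment> \<open>Moving against \<open>e\<close> keeps \<open>P\<close> fixed and lowers the
    height, so \<open>y\<close> is strictly below the graph although still in the closure of the
    domain.\<close>
  define y where "y = x - (r / 2) *\<^sub>R e"
  have "dist x y < r" using r(1) e by (simp add: y_def dist_norm)
  then have "y \<in> interior (closure \<Omega>) \<inter> U" using r(2) by (auto simp: subset_eq)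
  then have y: "y \<in> closure \<Omega>" "y \<in> U" using interior_subset by blast+
  have "P y = P x" by (simp add: y_def P_def inner_diff_left ee algebra_simps)
  moreover have "y \<bullet> e = x \<bullet> e - r / 2" by (simp add: y_def inner_diff_left ee)
  ultimately have "\<phi> (P y) - y \<bullet> e > 0" using x r(1) by simp
  then have "y \<in> U \<inter> {y. 0 < \<phi> (P y) - y \<bullet> e}" using y by simp
  moreover have "open (U \<inter> {y. 0 < \<phi> (P y) - y \<bullet> e})"
    using U cont by (intro open_Int open_Collect_less) auto
  ultimately have "U \<inter> {y. 0 < \<phi> (P y) - y \<bullet> e} \<inter> \<Omega> \<noteq> {}"
    using y(1) open_Int_closure_eq_empty by blast
  then obtain z where z: "z \<in> U" "\<phi> (P z) > z \<bullet> e" "z \<in> \<Omega>" by auto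
  then have "\<phi> (P z) < z \<bullet> e" using eq unfolding P_def by blast
  then show False using z(2) by simp
qed

section \<open>Piecewise affine functions on a mesh\<close>

text \<open>When the interiors are disjoint, at most one summand survives. On the skeleton and
  outside the mesh the value is 0, which is the normalization chosen for \<open>broken_P1\<close>
  and \<open>broken_P0\<close>.\<close>

definition broken :: "'a::topological_space set set \<Rightarrow> ('a set \<Rightarrow> 'a \<Rightarrow> 'b::real_vector) \<Rightarrow> 'a \<Rightarrow> 'b" where
  "broken \<T> h x = (\<Sum>T\<in>\<T>. indicator (interior T) x *\<^sub>R h T x)"

locale simplicial_mesh =
  fixes \<Omega> :: "(real^'n::finite) set" and \<T> :: "(real^'n) set set"
  assumes mesh: "conforming_mesh \<Omega> \<T>" and open_domain: "open \<Omega>" and bounded_domain: "bounded \<Omega>"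
begin

lemma finite_mesh: "finite \<T>"
  using mesh by (simp add: conforming_mesh_def triangulation_def)

lemma elem_simplex: "T \<in> \<T> \<Longrightarrow> int DIM(real^'n) simplex T"
  using mesh by (simp add: conforming_mesh_def)

lemma elem_subset: "T \<in> \<T> \<Longrightarrow> T \<subseteq> closure \<Omega>"
  using mesh by (auto simp: conforming_mesh_def)

lemma elem_compact: "T \<in> \<T> \<Longrightarrow> compact T"
  using elem_simplex compact_simplex by blast

lemma elem_interior_nonempty: "T \<in> \<T> \<Longrightarrow> interior T \<noteq> {}"
  using elem_simplex interior_full_simplex_nonempty by blast

lemma elem_subset_closure_interior: "T \<in> \<T> \<Longrightarrow> T \<subseteq> closure (interior T)"
  using elem_simplex elem_interior_nonempty convex_simplex convex_closure_interior closure_subset by metis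

text \<open>For distinct elements the intersection is a proper face of at least one of them, and a
  proper face misses the interior.\<close>

lemma elem_interiors_disjoint:
  assumes T: "T \<in> \<T>" and T': "T' \<in> \<T>" and ne: "T \<noteq> T'"
  shows "interior T \<inter> interior T' = {}"
proof -
  have f: "(T \<inter> T') face_of T" "(T' \<inter> T) face_of T'"
    using mesh T T' by (auto simp: conforming_mesh_def triangulation_def)
  consider "T \<inter> T' \<noteq> T" | "T' \<inter> T \<noteq> T'" using ne by blast
  then show ?thesis
  proof cases
    case 1
    then show ?thesis using face_of_disjoint_interior[OF f(1)] interior_subset by blast
  next
    case 2
    then show ?thesis using face_of_disjoint_interior[OF f(2)] interior_subset by blast
  qed
qed

lemma broken_eq:
  assumes "T \<in> \<T>" "x \<in> interior T"
  shows "broken \<T> h x = h T x"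
proof -
  have "(\<Sum>S\<in>\<T>. indicator (interior S) x *\<^sub>R h S x) = (\<Sum>S\<in>\<T>. if S = T then h S x else 0)"
    using elem_interiors_disjoint assms by (intro sum.cong) (auto simp: indicator_def)
  then show ?thesis using finite_mesh assms(1) by (simp add: broken_def)
qed

lemma broken_outside: "x \<notin> mesh_interior \<T> \<Longrightarrow> broken \<T> h x = 0"
  unfolding broken_def mesh_interior_def by (intro sum.neutral) auto

lemma brokenI:
  assumes "\<And>T x. T \<in> \<T> \<Longrightarrow> x \<in> interior T \<Longrightarrow> v x = h T x" "\<And>x. x \<notin> mesh_interior \<T> \<Longrightarrow> v x = 0"
  shows "v = broken \<T> h"
proof
  fix x
  show "v x = broken \<T> h x"
  proof (cases "x \<in> mesh_interior \<T>")
    case True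
    then obtain T where "T \<in> \<T>" "x \<in> interior T" by (auto simp: mesh_interior_def)
    then show ?thesis using assms(1) by (simp add: broken_eq)
  qed (simp add: assms(2) broken_outside)
qed

lemma broken_measurable:
  fixes h :: "(real^'n) set \<Rightarrow> real^'n \<Rightarrow> 'b::euclidean_space"
  assumes "\<And>T. continuous_on UNIV (h T)"
  shows "broken \<T> h \<in> borel_measurable borel"
  unfolding broken_def[abs_def] using assms
  by (intro borel_measurable_sum borel_measurable_scaleR borel_measurable_indicator
      borel_measurable_continuous_onI) auto

lemma broken_bounded:
  fixes h :: "(real^'n) set \<Rightarrow> real^'n \<Rightarrow> 'b::euclidean_space"
  assumes "\<And>T. continuous_on UNIV (h T)"
  shows "\<exists>B. \<forall>x. norm (broken \<T> h x) \<le> B"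
proof -
  have "\<exists>B\<ge>0. \<forall>x\<in>T. norm (h T x) \<le> B" if "T \<in> \<T>" for T
  proof -
    have "bounded (h T ` T)"
      using elem_compact[OF that] assms
      by (meson compact_continuous_image compact_imp_bounded continuous_on_subset subset_UNIV)
    then obtain B where "B > 0" "\<forall>y\<in>h T ` T. norm y \<le> B" unfolding bounded_pos by blast
    then show ?thesis by (intro exI[of _ B]) auto
  qed
  then obtain B where B: "\<And>T. T \<in> \<T> \<Longrightarrow> B T \<ge> 0" "\<And>T x. T \<in> \<T> \<Longrightarrow> x \<in> T \<Longrightarrow> norm (h T x) \<le> B T"
    by metis
  have "norm (broken \<T> h x) \<le> (\<Sum>T\<in>\<T>. B T)" for x
    unfolding broken_def
  proof (rule order_trans[OF norm_sum sum_mono])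
    fix T assume "T \<in> \<T>"
    then show "norm (indicator (interior T) x *\<^sub>R h T x) \<le> B T"
      using B interior_subset[of T] by (auto simp: indicator_def)
  qed
  then show ?thesis by blast
qed

section \<open>Integrals of elementwise constants over the domain\<close>

lemma domain_lmeasurable: "\<Omega> \<in> lmeasurable"
  using open_domain bounded_domain lmeasurable_open by blast

text \<open>Integrals run over \<Omega>, whereas the elements cover its closure, so only the part of
  an element interior lying in \<Omega> counts.\<close>

definition weight :: "(real^'n) set \<Rightarrow> real" where
  "weight T = measure lebesgue (interior T \<inter> \<Omega>)"

text \<open>An open set that meets the closure of \<Omega> meets \<Omega>, so the set being measured
  is open and nonempty.\<close>

lemma weight_pos:
  assumes "T \<in> \<T>"
  shows "weight T > 0"
proof -
  have "interior T \<inter> closure \<Omega> \<noteq> {}"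
    using elem_subset[OF assms] elem_interior_nonempty[OF assms] interior_subset by blast
  then have "interior T \<inter> \<Omega> \<noteq> {}" using open_Int_closure_eq_empty by blast
  moreover have "open (interior T \<inter> \<Omega>)" "bounded (interior T \<inter> \<Omega>)"
    using open_domain bounded_domain by (auto intro: bounded_subset)
  ultimately show ?thesis
    unfolding weight_def
    by (metis lmeasurable_open negligible_iff_measure0 open_not_negligible zero_less_measure_iff)
qed

lemma integral_broken_const:
  "(LINT x|lebesgue_on \<Omega>. broken \<T> (\<lambda>T _. c T) x) = (\<Sum>T\<in>\<T>. weight T * (c T :: real))"
proof -
  interpret finite_measure "lebesgue_on \<Omega>" using domain_lmeasurable by (rule finite_measure_lebesgue_on)
  have \<Omega>: "\<Omega> \<in> sets lebesgue" using domain_lmeasurable by blast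
  have i: "interior T \<inter> \<Omega> \<in> sets (lebesgue_on \<Omega>)" for T
    using \<Omega> by (simp add: sets_restrict_space_iff sets.Int)
  have int: "integrable (lebesgue_on \<Omega>) (\<lambda>x. indicator (interior T) x *\<^sub>R c T)" for T
  proof -
    have "integrable (lebesgue_on \<Omega>) (indicator (interior T \<inter> \<Omega>) :: _ \<Rightarrow> real)"
      using i[of T] by (intro integrable_real_indicator) (auto simp: less_top[symmetric])
    then have "integrable (lebesgue_on \<Omega>) (\<lambda>x. indicator (interior T \<inter> \<Omega>) x *\<^sub>R c T)"
      by (rule integrable_scaleR_left)
    then show ?thesis
      by (rule Bochner_Integration.integrable_cong[THEN iffD1, rotated -1]) (auto simp: indicator_def)
  qed
  have eq: "(LINT x|lebesgue_on \<Omega>. indicator (interior T) x *\<^sub>R c T) = weight T * c T" for T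
  proof -
    have "(LINT x|lebesgue_on \<Omega>. indicator (interior T) x *\<^sub>R c T)
      = (LINT x|lebesgue_on \<Omega>. indicator (interior T \<inter> \<Omega>) x * c T)"
      by (rule Bochner_Integration.integral_cong) (auto simp: indicator_def)
    also have "\<dots> = measure (lebesgue_on \<Omega>) (interior T \<inter> \<Omega>) * c T"
      using i[of T] by simp
    also have "measure (lebesgue_on \<Omega>) (interior T \<inter> \<Omega>) = weight T"
      unfolding weight_def using \<Omega> by (intro measure_restrict_space) auto
    finally show ?thesis .
  qed
  show ?thesis unfolding broken_def Bochner_Integration.integral_sum[OF int] eq by (rule refl)
qed

section \<open>Discrete fields in terms of their elementwise coefficients\<close>

lemma broken_P0_iff: "q \<in> broken_P0 \<T> \<longleftrightarrow> (\<exists>c. q = broken \<T> (\<lambda>T _. c T))"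
proof
  assume q: "q \<in> broken_P0 \<T>"
  then obtain c where "\<And>T x. T \<in> \<T> \<Longrightarrow> x \<in> interior T \<Longrightarrow> q x = c T"
    unfolding broken_P0_def mem_Collect_eq by metis
  then show "\<exists>c. q = broken \<T> (\<lambda>T _. c T)"
    using q by (intro exI[of _ c] brokenI) (auto simp: broken_P0_def)
next
  assume "\<exists>c. q = broken \<T> (\<lambda>T _. c T)"
  then show "q \<in> broken_P0 \<T>"
    by (auto simp: broken_P0_def broken_eq broken_outside)
qed

lemma broken_P1_iff: "v \<in> broken_P1 \<T> \<longleftrightarrow> (\<exists>A b. v = broken \<T> (\<lambda>T x. A T *v x + b T))"
proof
  assume v: "v \<in> broken_P1 \<T>"
  then obtain A b where "\<And>T x. T \<in> \<T> \<Longrightarrow> x \<in> interior T \<Longrightarrow> v x = A T *v x + b T"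
    unfolding broken_P1_def mem_Collect_eq by metis
  then show "\<exists>A b. v = broken \<T> (\<lambda>T x. A T *v x + b T)"
    using v by (intro exI[of _ A] exI[of _ b] brokenI) (auto simp: broken_P1_def)
next
  assume "\<exists>A b. v = broken \<T> (\<lambda>T x. A T *v x + b T)"
  then obtain A b where v: "v = broken \<T> (\<lambda>T x. A T *v x + b T)" by blast
  have "\<forall>x\<in>interior T. v x = A T *v x + b T" if "T \<in> \<T>" for T using that by (simp add: v broken_eq)
  moreover have "v x = 0" if "x \<notin> mesh_interior \<T>" for x using that by (simp add: v broken_outside)
  ultimately show "v \<in> broken_P1 \<T>" unfolding broken_P1_def by blast
qed

lemma broken_affine_grad:
  "broken_grad \<T> (broken \<T> (\<lambda>T x. A T *v x + b T)) = broken \<T> (\<lambda>T _. A T)"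
proof (rule brokenI)
  fix T x assume T: "T \<in> \<T>" and x: "x \<in> interior T"
  have "((\<lambda>x. A T *v x + b T) has_derivative (\<lambda>h. A T *v h)) (at x)"
    by (auto intro!: derivative_eq_intros bounded_linear_imp_has_derivative matrix_vector_mul_bounded_linear)
  then have "(broken \<T> (\<lambda>T x. A T *v x + b T) has_derivative (\<lambda>h. A T *v h)) (at x)"
    using x T by (rule_tac has_derivative_transform_within_open[of _ _ _ _ "interior T"]) (auto simp: broken_eq)
  then have "frechet_derivative (broken \<T> (\<lambda>T x. A T *v x + b T)) (at x) = (\<lambda>h. A T *v h)"
    by (rule frechet_derivative_at[symmetric])
  then show "broken_grad \<T> (broken \<T> (\<lambda>T x. A T *v x + b T)) x = A T"
    using T x by (auto simp: broken_grad_def jacobian_def mesh_interior_def)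
qed (simp add: broken_grad_def)

lemma comb_broken_affine:
  "comb (broken \<T> (\<lambda>T x. A T *v x + b T)) c (broken \<T> (\<lambda>T x. A' T *v x + b' T)) =
    broken \<T> (\<lambda>T x. (A T + c *\<^sub>R A' T) *v x + (b T + c *\<^sub>R b' T))"
  by (rule brokenI)
    (simp_all add: comb_def broken_eq broken_outside matrix_vector_mult_add_rdistrib
      scaleR_matrix_vector_assoc algebra_simps)

lemma fun_subspace_broken_P1: "fun_subspace (broken_P1 \<T>)"
proof -
  have "(\<lambda>_. 0) \<in> broken_P1 \<T>" by (auto simp: broken_P1_def intro!: exI[of _ 0])
  moreover have "comb u c v \<in> broken_P1 \<T>" if uv: "u \<in> broken_P1 \<T>" "v \<in> broken_P1 \<T>" for u v c
  proof -
    obtain A b A' b' where u: "u = broken \<T> (\<lambda>T x. A T *v x + b T)" and v: "v = broken \<T> (\<lambda>T x. A' T *v x + b' T)"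
      using uv[unfolded broken_P1_iff] by (elim exE) (rule that)
    show ?thesis unfolding broken_P1_iff u v comb_broken_affine by (intro exI) (rule refl)
  qed
  ultimately show ?thesis by (auto simp: fun_subspace_def)
qed

lemma broken_grad_comb:
  assumes "u \<in> broken_P1 \<T>" "v \<in> broken_P1 \<T>"
  shows "broken_grad \<T> (comb u c v) x = broken_grad \<T> u x + c *\<^sub>R broken_grad \<T> v x"
proof -
  obtain A b A' b' where u: "u = broken \<T> (\<lambda>T x. A T *v x + b T)" and v: "v = broken \<T> (\<lambda>T x. A' T *v x + b' T)"
    using assms unfolding broken_P1_iff by blast
  show ?thesis
    unfolding u v comb_broken_affine broken_affine_grad
    by (simp add: broken_def scaleR_right_distrib sum.distrib scaleR_sum_right mult.commute)
qed

lemma broken_div_comb: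
  assumes "u \<in> broken_P1 \<T>" "v \<in> broken_P1 \<T>"
  shows "broken_div \<T> (comb u c v) x = broken_div \<T> u x + c * broken_div \<T> v x"
  using broken_grad_comb[OF assms]
  by (simp add: broken_div_def trace_def sum.distrib sum_distrib_left)

lemma broken_div_P0:
  assumes "v \<in> broken_P1 \<T>"
  shows "broken_div \<T> v \<in> broken_P0 \<T>"
proof -
  obtain A b where v: "v = broken \<T> (\<lambda>T x. A T *v x + b T)" using assms unfolding broken_P1_iff by blast
  have "broken_div \<T> v = broken \<T> (\<lambda>T _. trace (A T))"
    unfolding v broken_div_def broken_affine_grad
    by (rule brokenI) (simp_all add: broken_eq broken_outside trace_def)
  then show ?thesis unfolding broken_P0_iff by (rule exI[of _ "\<lambda>T. trace (A T)"])
qed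

lemma strain_comb:
  assumes "u \<in> broken_P1 \<T>" "v \<in> broken_P1 \<T>"
  shows "strain \<T> (comb u c v) x = strain \<T> u x + c *\<^sub>R strain \<T> v x"
  using broken_grad_comb[OF assms]
  by (simp add: strain_def transpose_def vec_eq_iff algebra_simps)

lemma stress0_comb:
  assumes "u \<in> broken_P1 \<T>" "v \<in> broken_P1 \<T>"
  shows "stress0 \<mu> \<T> (comb u c v) x = stress0 \<mu> \<T> u x + c *\<^sub>R stress0 \<mu> \<T> v x"
  unfolding stress0_def strain_comb[OF assms] broken_div_comb[OF assms]
  by (simp add: algebra_simps)

section \<open>One-sided traces\<close>

lemma elem_trace_affine:
  assumes T: "T \<in> \<T>" and x: "x \<in> T"
  shows "elem_trace T (broken \<T> (\<lambda>T x. A T *v x + b T)) x = A T *v x + b T"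
  unfolding elem_trace_def
proof (rule tendsto_Lim)
  have "x islimpt interior T"
  proof (cases "x \<in> interior T")
    case True
    then show ?thesis by (simp add: interior_limit_point)
  next
    case False
    then show ?thesis using elem_subset_closure_interior[OF T] x by (auto simp: closure_def)
  qed
  then show "\<not> trivial_limit (at x within interior T)" by (simp add: trivial_limit_within)
  have "((\<lambda>x. A T *v x + b T) \<longlongrightarrow> A T *v x + b T) (at x within interior T)"
    by (intro tendsto_intros bounded_linear.tendsto[OF matrix_vector_mul_bounded_linear])
  then show "(broken \<T> (\<lambda>T x. A T *v x + b T) \<longlongrightarrow> A T *v x + b T) (at x within interior T)"
    by (rule Lim_transform_eventually) (auto simp: eventually_at_filter broken_eq[OF T])
qed

text \<open>Off the element the trace is a limit along the trivial filter, hence an unspecified constant.\<close>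

lemma elem_trace_outside:
  assumes "T \<in> \<T>" "x \<notin> T"
  shows "elem_trace T v x = (THE l. True)"
proof -
  have "closed T" using elem_compact[OF assms(1)] compact_imp_closed by blast
  then have "\<not> x islimpt interior T"
    using assms(2) closed_limpt interior_subset islimpt_subset by blast
  then have "at x within interior T = bot" by (simp flip: trivial_limit_within)
  then show ?thesis by (simp add: elem_trace_def t2_space_class.Lim_def)
qed

text \<open>The trace is affine on the compact element and constant off it, so both properties hold
  on the whole space, where the face measure lives.\<close>

lemma elem_trace_measurable_bounded:
  assumes T: "T \<in> \<T>" and v: "v \<in> broken_P1 \<T>"
  shows "elem_trace T v \<in> borel_measurable borel" "\<exists>B. \<forall>x. norm (elem_trace T v x) \<le> B"
proof -
  obtain A b where v: "v = broken \<T> (\<lambda>T x. A T *v x + b T)" using v unfolding broken_P1_iff by blast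
  have eq: "elem_trace T v = (\<lambda>x. if x \<in> T then A T *v x + b T else (THE l. True))"
    using T by (auto simp: v elem_trace_affine elem_trace_outside)
  have cont: "continuous_on S (\<lambda>x. A T *v x + b T)" for S
    by (intro continuous_intros)
  have "T \<in> sets borel" using elem_compact[OF T] by (rule borel_compact)
  then show "elem_trace T v \<in> borel_measurable borel"
    unfolding eq using cont by (intro measurable_If_set borel_measurable_continuous_onI) auto
  have "bounded ((\<lambda>x. A T *v x + b T) ` T)"
    using elem_compact[OF T] cont by (intro compact_imp_bounded compact_continuous_image)
  then obtain B where "\<And>x. x \<in> T \<Longrightarrow> norm (A T *v x + b T) \<le> B" unfolding bounded_iff by blast
  then show "\<exists>B. \<forall>x. norm (elem_trace T v x) \<le> B"
    by (intro exI[of _ "max B (norm (THE l::real^'n. True))"]) (auto simp: eq le_max_iff_disj)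
qed

lemma elem_trace_comb:
  assumes "T \<in> \<T>" "x \<in> T" "u \<in> broken_P1 \<T>" "v \<in> broken_P1 \<T>"
  shows "elem_trace T (comb u c v) x = elem_trace T u x + c *\<^sub>R elem_trace T v x"
proof -
  obtain A b A' b' where u: "u = broken \<T> (\<lambda>T x. A T *v x + b T)" and v: "v = broken \<T> (\<lambda>T x. A' T *v x + b' T)"
    using assms unfolding broken_P1_iff by blast
  show ?thesis
    unfolding u v comb_broken_affine elem_trace_affine[OF assms(1,2)]
    by (simp add: matrix_vector_mult_add_rdistrib scaleR_matrix_vector_assoc algebra_simps)
qed

end

section \<open>Jumps and the Crouzeix--Raviart space\<close>

lemma bounded_linear_tangential: "bounded_linear (tangential n)"
  unfolding tangential_def[abs_def]
  by (intro bounded_linear_sub bounded_linear_ident bounded_linear_scaleR_left bounded_linear_compose[OF bounded_linear_scaleR_left] bounded_linear_inner_left)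

lemma square_integrable_imp_integrable:
  assumes "finite_measure M" "square_integrable M t"
  shows "integrable M t"
proof -
  interpret finite_measure M by fact
  have "integrable M (\<lambda>x. 1 + (norm (t x))\<^sup>2)"
    using assms(2) by (simp add: square_integrable_def)
  moreover have "norm (t x) \<le> 1 + (norm (t x))\<^sup>2" for x
    using self_le_power[of "norm (t x)" 2] by (cases "norm (t x) \<le> 1") (auto intro: order_trans)
  ultimately show ?thesis
    using assms(2) by (elim Bochner_Integration.integrable_bound) (auto simp: square_integrable_def)
qed

lemma square_integrable_inner_bounded:
  fixes t h :: "'a \<Rightarrow> 'b::euclidean_space"
  assumes "finite_measure M" "square_integrable M t" "h \<in> borel_measurable M" "\<And>x. norm (h x) \<le> B"
  shows "integrable M (\<lambda>x. t x \<bullet> h x)"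
proof -
  have t: "integrable M t" using assms(1,2) by (rule square_integrable_imp_integrable)
  then have "integrable M (\<lambda>x. B * norm (t x))" by (intro integrable_mult_right integrable_norm)
  then show ?thesis
  proof (rule Bochner_Integration.integrable_bound)
    show "(\<lambda>x. t x \<bullet> h x) \<in> borel_measurable M" using t assms(3) by measurable
    have "norm (t x \<bullet> h x) \<le> norm (B * norm (t x))" for x
    proof -
      have "\<bar>t x \<bullet> h x\<bar> \<le> norm (t x) * norm (h x)" by (rule Cauchy_Schwarz_ineq2)
      also have "\<dots> \<le> norm (t x) * B" using assms(4) by (intro mult_left_mono) auto
      finally show ?thesis by (simp add: mult.commute)
    qed
    then show "AE x in M. norm (t x \<bullet> h x) \<le> norm (B * norm (t x))" by simp
  qed
qed

lemma integrable_inner_bounded: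
  fixes t h :: "'a \<Rightarrow> 'b::euclidean_space"
  assumes "finite_measure M" "t \<in> borel_measurable M" "h \<in> borel_measurable M"
    and "\<And>x. norm (t x) \<le> A" "\<And>x. norm (h x) \<le> B"
  shows "integrable M (\<lambda>x. t x \<bullet> h x)"
proof -
  interpret finite_measure M by fact
  have "norm (t x \<bullet> h x) \<le> A * B" for x
  proof -
    have "\<bar>t x \<bullet> h x\<bar> \<le> norm (t x) * norm (h x)" by (rule Cauchy_Schwarz_ineq2)
    also have "\<dots> \<le> A * B"
      using assms(4,5)[of x] order_trans[OF norm_ge_zero assms(4)] by (intro mult_mono) auto
    finally show ?thesis by simp
  qed
  then show ?thesis using assms(2,3) by (intro integrable_const_bound[of _ "A * B"]) auto
qed

lemma measurable_lebesgue_on_borel: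
  "h \<in> borel_measurable borel \<Longrightarrow> h \<in> borel_measurable (lebesgue_on S)"
  by (intro measurable_restrict_space1 measurable_completion) simp

context simplicial_mesh
begin

lemma mesh_face_elem_plus:
  assumes "F \<in> mesh_faces \<T>"
  shows "elem_plus \<T> F \<in> \<T>" "F facet_of elem_plus \<T> F"
proof -
  have "\<exists>T. T \<in> \<T> \<and> F facet_of T" using assms by (auto simp: mesh_faces_def)
  then have "elem_plus \<T> F \<in> \<T> \<and> F facet_of elem_plus \<T> F" unfolding elem_plus_def by (rule someI_ex)
  then show "elem_plus \<T> F \<in> \<T>" "F facet_of elem_plus \<T> F" by auto
qed

lemma interior_face_elem_minus:
  assumes "F \<in> interior_faces \<T>"
  shows "elem_minus \<T> F \<in> \<T>" "F facet_of elem_minus \<T> F"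
proof -
  have "\<exists>T. T \<in> \<T> \<and> F facet_of T \<and> T \<noteq> elem_plus \<T> F" using assms by (auto simp: interior_faces_def)
  then have "elem_minus \<T> F \<in> \<T> \<and> F facet_of elem_minus \<T> F \<and> elem_minus \<T> F \<noteq> elem_plus \<T> F"
    unfolding elem_minus_def by (rule someI_ex)
  then show "elem_minus \<T> F \<in> \<T>" "F facet_of elem_minus \<T> F" by auto
qed

lemma interior_faces_subset: "interior_faces \<T> \<subseteq> mesh_faces \<T>"
  and faces_on_subset: "faces_on \<T> \<Gamma> \<subseteq> mesh_faces \<T>"
  by (auto simp: interior_faces_def faces_on_def mesh_faces_def)

lemma mesh_face_flat: "F \<in> mesh_faces \<T> \<Longrightarrow> flat_piece F"
  using mesh_face_elem_plus elem_simplex flat_piece_facet by blast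

lemma mesh_face_rel_interior_nonempty:
  assumes "F \<in> mesh_faces \<T>"
  shows "rel_interior F \<noteq> {}"
proof -
  note F = mesh_face_elem_plus[OF assms]
  have "convex F" using F elem_simplex convex_simplex facet_of_imp_face_of face_of_imp_convex by blast
  moreover have "F \<noteq> {}" using F(2) by (simp add: facet_of_def)
  ultimately show ?thesis by (simp add: rel_interior_eq_empty)
qed

text \<open>Stated on the face only: off an element the trace is one fixed unspecified constant for
  all fields, so additivity cannot be expected there.\<close>

lemma jump_comb:
  assumes F: "F \<in> mesh_faces \<T>" and x: "x \<in> F" and uv: "u \<in> broken_P1 \<T>" "v \<in> broken_P1 \<T>"
  shows "jump \<T> F (comb u c v) x = jump \<T> F u x + c *\<^sub>R jump \<T> F v x"
proof -
  have p: "x \<in> elem_plus \<T> F" using mesh_face_elem_plus[OF F] x facet_of_imp_subset by blast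
  note plus = elem_trace_comb[OF mesh_face_elem_plus(1)[OF F] p uv]
  show ?thesis
  proof (cases "F \<in> interior_faces \<T>")
    case True
    have m: "x \<in> elem_minus \<T> F" using interior_face_elem_minus[OF True] x facet_of_imp_subset by blast
    show ?thesis
      using True plus elem_trace_comb[OF interior_face_elem_minus(1)[OF True] m uv]
      by (simp add: jump_def algebra_simps)
  qed (simp add: jump_def plus)
qed

lemma jump_measurable_bounded:
  assumes F: "F \<in> mesh_faces \<T>" and v: "v \<in> broken_P1 \<T>"
  shows "jump \<T> F v \<in> borel_measurable borel" "\<exists>B. \<forall>x. norm (jump \<T> F v x) \<le> B"
proof -
  note plus = elem_trace_measurable_bounded[OF mesh_face_elem_plus(1)[OF F] v]
  have "jump \<T> F v \<in> borel_measurable borel \<and> (\<exists>B. \<forall>x. norm (jump \<T> F v x) \<le> B)"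
  proof (cases "F \<in> interior_faces \<T>")
    case True
    note minus = elem_trace_measurable_bounded[OF interior_face_elem_minus(1)[OF True] v]
    obtain B1 B2 where B: "\<And>x. norm (elem_trace (elem_plus \<T> F) v x) \<le> B1"
      "\<And>x. norm (elem_trace (elem_minus \<T> F) v x) \<le> B2"
      using plus(2) minus(2) by blast
    have eq: "jump \<T> F v = (\<lambda>x. elem_trace (elem_plus \<T> F) v x - elem_trace (elem_minus \<T> F) v x)"
      using True by (auto simp: jump_def)
    have "norm (jump \<T> F v x) \<le> B1 + B2" for x
      unfolding eq using B by (intro order_trans[OF norm_triangle_ineq4] add_mono)
    then show ?thesis using plus(1) minus(1) unfolding eq by (auto intro: borel_measurable_diff)
  next
    case False
    then have "jump \<T> F v = elem_trace (elem_plus \<T> F) v" by (auto simp: jump_def)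
    then show ?thesis using plus by simp
  qed
  then show "jump \<T> F v \<in> borel_measurable borel" "\<exists>B. \<forall>x. norm (jump \<T> F v x) \<le> B" by auto
qed

lemma linear_jump_measurable_bounded:
  fixes \<psi> :: "real^'n \<Rightarrow> 'b::euclidean_space"
  assumes F: "F \<in> mesh_faces \<T>" and v: "v \<in> broken_P1 \<T>" and \<psi>: "bounded_linear \<psi>"
  shows "(\<lambda>x. \<psi> (jump \<T> F v x)) \<in> borel_measurable borel" "\<exists>B. \<forall>x. norm (\<psi> (jump \<T> F v x)) \<le> B"
proof -
  note j = jump_measurable_bounded[OF F v]
  have "\<psi> \<in> borel_measurable borel"
    using \<psi> by (intro borel_measurable_continuous_onI linear_continuous_on)
  from measurable_compose[OF j(1) this]
  show "(\<lambda>x. \<psi> (jump \<T> F v x)) \<in> borel_measurable borel" .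
  obtain K where K: "K > 0" "\<And>y. norm (\<psi> y) \<le> norm y * K" using bounded_linear.pos_bounded[OF \<psi>] by blast
  obtain B where B: "\<And>x. norm (jump \<T> F v x) \<le> B" using j(2) by blast
  have "norm (\<psi> (jump \<T> F v x)) \<le> B * K" for x
    using K(2)[of "jump \<T> F v x"] mult_right_mono[OF B[of x], of K] K(1) by linarith
  then show "\<exists>B. \<forall>x. norm (\<psi> (jump \<T> F v x)) \<le> B" by blast
qed

lemma integrable_linear_jump:
  fixes \<psi> :: "real^'n \<Rightarrow> 'b::euclidean_space"
  assumes F: "F \<in> mesh_faces \<T>" and v: "v \<in> broken_P1 \<T>" and \<psi>: "bounded_linear \<psi>"
  shows "integrable (face_measure F) (\<lambda>x. \<psi> (jump \<T> F v x))"
  using linear_jump_measurable_bounded[OF assms] integrable_face_measure_bounded[OF mesh_face_flat[OF F]] by blast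

text \<open>Common source of linearity for all face terms: \<open>\<Phi> x\<close> may be a fixed
  linear map as in the conditions of \<open>CR_space\<close>, the product with another jump as in
  \<open>a_form\<close>, or the pairing with data as in \<open>load\<close>. Integrability has a
  different reason in each case and is therefore a premise.\<close>

lemma integral_jump_comb:
  fixes \<Phi> :: "real^'n \<Rightarrow> real^'n \<Rightarrow> 'b::euclidean_space"
  assumes F: "F \<in> mesh_faces \<T>" and uv: "u \<in> broken_P1 \<T>" "v \<in> broken_P1 \<T>"
    and lin: "\<And>x. linear (\<Phi> x)"
    and int: "\<And>w. w \<in> broken_P1 \<T> \<Longrightarrow> integrable (face_measure F) (\<lambda>x. \<Phi> x (jump \<T> F w x))"
  shows "(LINT x|face_measure F. \<Phi> x (jump \<T> F (comb u c v) x)) =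
    (LINT x|face_measure F. \<Phi> x (jump \<T> F u x)) + c *\<^sub>R (LINT x|face_measure F. \<Phi> x (jump \<T> F v x))"
proof -
  note int_u = int[OF uv(1)] and int_v = int[OF uv(2)]
  have "(LINT x|face_measure F. \<Phi> x (jump \<T> F (comb u c v) x)) =
    (LINT x|face_measure F. \<Phi> x (jump \<T> F u x) + c *\<^sub>R \<Phi> x (jump \<T> F v x))"
  proof (rule integral_cong_AE)
    show "(\<lambda>x. \<Phi> x (jump \<T> F (comb u c v) x)) \<in> borel_measurable (face_measure F)"
      using int[OF fun_subspace_comb[OF fun_subspace_broken_P1 uv]] by (rule borel_measurable_integrable)
    show "(\<lambda>x. \<Phi> x (jump \<T> F u x) + c *\<^sub>R \<Phi> x (jump \<T> F v x)) \<in> borel_measurable (face_measure F)"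
      using int_u int_v by (intro borel_measurable_integrable) auto
    show "AE x in face_measure F. \<Phi> x (jump \<T> F (comb u c v) x) =
      \<Phi> x (jump \<T> F u x) + c *\<^sub>R \<Phi> x (jump \<T> F v x)"
      using AE_face_measure[OF mesh_face_flat[OF F]]
      by eventually_elim (simp add: jump_comb[OF F _ uv] linear_add[OF lin] linear_scale[OF lin])
  qed
  also have "\<dots> = (LINT x|face_measure F. \<Phi> x (jump \<T> F u x)) + c *\<^sub>R (LINT x|face_measure F. \<Phi> x (jump \<T> F v x))"
    using int_u int_v by simp
  finally show ?thesis .
qed

lemma integral_linear_jump_comb:
  fixes \<psi> :: "real^'n \<Rightarrow> 'b::euclidean_space"
  assumes "F \<in> mesh_faces \<T>" "u \<in> broken_P1 \<T>" "v \<in> broken_P1 \<T>" "bounded_linear \<psi>"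
  shows "(LINT x|face_measure F. \<psi> (jump \<T> F (comb u c v) x)) =
    (LINT x|face_measure F. \<psi> (jump \<T> F u x)) + c *\<^sub>R (LINT x|face_measure F. \<psi> (jump \<T> F v x))"
  by (rule integral_jump_comb[of F u v "\<lambda>_. \<psi>"])
    (use assms integrable_linear_jump in \<open>auto simp: bounded_linear.linear\<close>)

text \<open>Integrability of \<open>w\<close> allows the integral of the difference to be split;
  otherwise the Bochner integral would be subject to its default value 0. Afterwards field and data
  appear linearly and separately.\<close>

lemma CR_space_iff:
  assumes "\<forall>F\<in>faces_on \<T> \<Gamma>D. integrable (face_measure F) w"
  shows "v \<in> CR_space \<T> \<Gamma>D \<Gamma>S \<Gamma>E w \<longleftrightarrow> v \<in> broken_P1 \<T> \<and>
     (\<forall>F\<in>interior_faces \<T>. (LINT x|face_measure F. jump \<T> F v x) = 0) \<and>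
     (\<forall>F\<in>faces_on \<T> \<Gamma>D. (LINT x|face_measure F. jump \<T> F v x) = (LINT x|face_measure F. w x)) \<and>
     (\<forall>F\<in>faces_on \<T> \<Gamma>S. (LINT x|face_measure F. jump \<T> F v x \<bullet> outer_normal \<T> F) = 0) \<and>
     (\<forall>F\<in>faces_on \<T> \<Gamma>E. (LINT x|face_measure F. tangential (outer_normal \<T> F) (jump \<T> F v x)) = 0)"
proof -
  have "(LINT x|face_measure F. jump \<T> F v x - w x) =
    (LINT x|face_measure F. jump \<T> F v x) - (LINT x|face_measure F. w x)"
    if "v \<in> broken_P1 \<T>" "F \<in> faces_on \<T> \<Gamma>D" for F
    using assms that integrable_linear_jump[OF _ that(1) bounded_linear_ident] faces_on_subset
    by (intro Bochner_Integration.integral_diff) blast+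
  then show ?thesis by (auto simp: CR_space_def)
qed

lemma CR_space_P1: "CR_space \<T> \<Gamma>D \<Gamma>S \<Gamma>E w \<subseteq> broken_P1 \<T>"
  by (auto simp: CR_space_def)

text \<open>Only face integrals of the data matter. The instances used are closure of the
  homogeneous space, invariance of the Dirichlet class under homogeneous fields, and homogeneity of
  differences within that class.\<close>

lemma CR_space_comb:
  assumes int: "\<forall>F\<in>faces_on \<T> \<Gamma>D. integrable (face_measure F) w"
      "\<forall>F\<in>faces_on \<T> \<Gamma>D. integrable (face_measure F) w'"
      "\<forall>F\<in>faces_on \<T> \<Gamma>D. integrable (face_measure F) w''"
    and w: "\<And>F. F \<in> faces_on \<T> \<Gamma>D \<Longrightarrow> (LINT x|face_measure F. w'' x) =
      (LINT x|face_measure F. w x) + c *\<^sub>R (LINT x|face_measure F. w' x)"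
    and u: "u \<in> CR_space \<T> \<Gamma>D \<Gamma>S \<Gamma>E w" and v: "v \<in> CR_space \<T> \<Gamma>D \<Gamma>S \<Gamma>E w'"
  shows "comb u c v \<in> CR_space \<T> \<Gamma>D \<Gamma>S \<Gamma>E w''"
proof -
  note u = u[unfolded CR_space_iff[OF int(1)]] and v = v[unfolded CR_space_iff[OF int(2)]]
  have uv: "u \<in> broken_P1 \<T>" "v \<in> broken_P1 \<T>" using u v by auto
  note eq = integral_linear_jump_comb[OF _ uv]
  show ?thesis
    unfolding CR_space_iff[OF int(3)]
  proof (intro conjI ballI)
    show "comb u c v \<in> broken_P1 \<T>" using uv by (rule fun_subspace_comb[OF fun_subspace_broken_P1])
    show "(LINT x|face_measure F. jump \<T> F (comb u c v) x) = 0" if "F \<in> interior_faces \<T>" for F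
      using eq[OF subsetD[OF interior_faces_subset that] bounded_linear_ident] u v that by simp
    show "(LINT x|face_measure F. jump \<T> F (comb u c v) x) = (LINT x|face_measure F. w'' x)"
      if "F \<in> faces_on \<T> \<Gamma>D" for F
      using eq[OF subsetD[OF faces_on_subset that] bounded_linear_ident] u v that w by simp
    show "(LINT x|face_measure F. jump \<T> F (comb u c v) x \<bullet> outer_normal \<T> F) = 0"
      if "F \<in> faces_on \<T> \<Gamma>S" for F
      using eq[OF subsetD[OF faces_on_subset that] bounded_linear_inner_left] u v that by simp
    show "(LINT x|face_measure F. tangential (outer_normal \<T> F) (jump \<T> F (comb u c v) x)) = 0"
      if "F \<in> faces_on \<T> \<Gamma>E" for F
      using eq[OF subsetD[OF faces_on_subset that] bounded_linear_tangential] u v that by simp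
  qed
qed

lemma fun_subspace_CR_space: "fun_subspace (CR_space \<T> \<Gamma>D \<Gamma>S \<Gamma>E (\<lambda>_. 0))"
proof -
  \<comment> \<open>The zero field equals itself minus itself, so additivity on the face makes its
    jump vanish.\<close>
  have "jump \<T> F (\<lambda>_. 0) x = 0" if "F \<in> mesh_faces \<T>" "x \<in> F" for F x
    using jump_comb[OF that, of "\<lambda>_. 0" "\<lambda>_. 0" "- 1"] fun_subspace_0[OF fun_subspace_broken_P1]
    by (simp add: comb_def)
  then have AE: "AE x in face_measure F. jump \<T> F (\<lambda>_. 0) x = 0" if "F \<in> mesh_faces \<T>" for F
    using AE_face_measure[OF mesh_face_flat[OF that]] that by (auto elim: eventually_mono)
  have 0: "(LINT x|face_measure F. \<psi> (jump \<T> F (\<lambda>_. 0) x)) = 0"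
    if "F \<in> mesh_faces \<T>" "bounded_linear \<psi>" for F and \<psi> :: "real^'n \<Rightarrow> 'b::euclidean_space"
  proof (rule integral_eq_zero_AE)
    show "AE x in face_measure F. \<psi> (jump \<T> F (\<lambda>_. 0) x) = 0"
      using AE[OF that(1)] by eventually_elim (simp add: linear_0 bounded_linear.linear that(2))
  qed
  have "(\<lambda>_. 0) \<in> CR_space \<T> \<Gamma>D \<Gamma>S \<Gamma>E (\<lambda>_. 0)"
    using fun_subspace_0[OF fun_subspace_broken_P1] 0[OF _ bounded_linear_ident]
      0[OF _ bounded_linear_inner_left] 0[OF _ bounded_linear_tangential]
      interior_faces_subset faces_on_subset
    by (subst CR_space_iff) (auto simp: subset_iff)
  then show ?thesis
    unfolding fun_subspace_def by (auto intro!: CR_space_comb[where w = "\<lambda>_. 0" and w' = "\<lambda>_. 0"])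
qed

text \<open>A relative interior point of a shared facet is interior to the union of the two
  elements, hence to the closure of \<Omega>; a frontier point of a Lipschitz domain never
  is.\<close>

lemma boundary_face_not_interior:
  assumes "lipschitz_domain \<Omega>" "F \<in> faces_on \<T> (frontier \<Omega>)"
  shows "F \<notin> interior_faces \<T>"
proof
  assume "F \<in> interior_faces \<T>"
  then obtain T T' where T: "T \<in> \<T>" "F facet_of T" "T' \<in> \<T>" "F facet_of T'" "T \<noteq> T'"
    by (auto simp: interior_faces_def)
  obtain x where x: "x \<in> rel_interior F"
    using mesh_face_rel_interior_nonempty assms(2) faces_on_subset by blast
  have "x \<in> interior (T \<union> T')"
    using shared_facet_interior[OF elem_simplex[OF T(1)] T(2) elem_simplex[OF T(3)] T(4) _ x]
      elem_interiors_disjoint[OF T(1,3,5)] by blast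
  also have "\<dots> \<subseteq> interior (closure \<Omega>)" using elem_subset T(1,3) by (intro interior_mono) blast
  finally show False
    using lipschitz_domain_frontier[OF assms(1) open_domain, of x] assms(2) x by (auto simp: faces_on_def)
qed

lemma integral_elem_trace_affine:
  fixes A :: "(real^'n) set \<Rightarrow> real^'n^'n"
  assumes T: "T \<in> \<T>" and F: "F facet_of T"
  shows "(LINT x|face_measure F. elem_trace T (broken \<T> (\<lambda>T x. A T *v x + b T)) x) =
    (LINT x|face_measure F. A T *v x + b T)"
proof (rule integral_cong_AE)
  have flat: "flat_piece F" using elem_simplex[OF T] F by (rule flat_piece_facet)
  have "broken \<T> (\<lambda>T x. A T *v x + b T) \<in> broken_P1 \<T>" unfolding broken_P1_iff by blast
  then show "elem_trace T (broken \<T> (\<lambda>T x. A T *v x + b T)) \<in> borel_measurable (face_measure F)"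
    using elem_trace_measurable_bounded(1)[OF T] by simp
  have "continuous_on UNIV (\<lambda>x. A T *v x + b T)" by (intro continuous_intros)
  then show "(\<lambda>x. A T *v x + b T) \<in> borel_measurable (face_measure F)"
    by (simp add: borel_measurable_continuous_onI)
  show "AE x in face_measure F. elem_trace T (broken \<T> (\<lambda>T x. A T *v x + b T)) x = A T *v x + b T"
    using AE_face_measure[OF flat] by eventually_elim (use elem_trace_affine[OF T] facet_of_imp_subset[OF F] in auto)
qed

text \<open>Covers the division by \<open>face_area F\<close> in the prescribed means: at area 0 the
  quotient defaults to 0, and so does the integral of the data.\<close>

lemma integral_face_measure_null:
  assumes "flat_piece F" "face_area F = 0"
  shows "(LINT x|face_measure F. h x) = 0"
proof (rule integral_eq_zero_AE)
  interpret finite_measure "face_measure F" by (rule finite_face_measure[OF assms(1)])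
  have "emeasure (face_measure F) UNIV = 0"
    using face_area_eq[OF assms(1)] assms(2) by (simp add: emeasure_eq_measure)
  then have "UNIV \<in> null_sets (face_measure F)" by (intro null_setsI) auto
  then show "AE x in face_measure F. h x = 0" by (rule AE_I') simp
qed

lemma CR_space_nonempty:
  assumes int: "\<forall>F\<in>faces_on \<T> \<Gamma>D. integrable (face_measure F) g"
    and lip: "lipschitz_domain \<Omega>" and part: "boundary_partition \<Omega> \<Gamma>D \<Gamma>N \<Gamma>S \<Gamma>E"
  shows "\<exists>u. u \<in> CR_space \<T> \<Gamma>D \<Gamma>S \<Gamma>E g"
proof -
  have \<Gamma>D: "\<Gamma>D \<subseteq> frontier \<Omega>" "\<Gamma>D \<inter> \<Gamma>S = {}" "\<Gamma>D \<inter> \<Gamma>E = {}"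
    using part by (auto simp: boundary_partition_def dest: openin_imp_subset)
  \<comment> \<open>On a Dirichlet face the jump must be the one-sided trace, otherwise the two
    traces would cancel.\<close>
  have notint: "F \<notin> interior_faces \<T>" if "F \<in> faces_on \<T> \<Gamma>D" for F
    using that \<Gamma>D(1) boundary_face_not_interior[OF lip] by (auto simp: faces_on_def)
  have notD: "F \<notin> faces_on \<T> \<Gamma>D" if "F \<in> faces_on \<T> \<Gamma>S \<union> faces_on \<T> \<Gamma>E" for F
  proof
    assume D: "F \<in> faces_on \<T> \<Gamma>D"
    then have "rel_interior F \<noteq> {}" using mesh_face_rel_interior_nonempty faces_on_subset by blast
    then show False using that D \<Gamma>D(2,3) by (auto simp: faces_on_def)
  qed
  \<comment> \<open>The mean depends on the face and not on the element, so it is the same from both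
    sides of an interior face. On faces of \<open>\<Gamma>S\<close> and \<open>\<Gamma>E\<close> the
    whole mean is zero, hence also its normal and tangential parts.\<close>
  define m where "m F = (if F \<in> faces_on \<T> \<Gamma>D then (1 / face_area F) *\<^sub>R (LINT x|face_measure F. g x) else 0)" for F
  have "\<exists>A b. \<forall>F. F facet_of T \<longrightarrow> (LINT x|face_measure F. A *v x + b) = face_area F *\<^sub>R m F" if T: "T \<in> \<T>" for T
  proof -
    obtain f b where f: "linear f"
      "\<And>F. F facet_of T \<Longrightarrow> (LINT x|face_measure F. f x + b) = face_area F *\<^sub>R m F"
      using facet_mean_interpolation[OF elem_simplex[OF T], of m] by blast
    have "(*v) (matrix f) = f" using matrix_vector_mul(2)[OF f(1)] by simp
    then show ?thesis using f(2) by (intro exI[of _ "matrix f"] exI[of _ b]) simp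
  qed
  then obtain A b where Ab: "\<And>T F. T \<in> \<T> \<Longrightarrow> F facet_of T \<Longrightarrow>
    (LINT x|face_measure F. A T *v x + b T) = face_area F *\<^sub>R m F"
    by metis
  define u where "u = broken \<T> (\<lambda>T x. A T *v x + b T)"
  have u: "u \<in> broken_P1 \<T>" unfolding broken_P1_iff u_def by blast
  have trace: "(LINT x|face_measure F. elem_trace T u x) = face_area F *\<^sub>R m F" if "T \<in> \<T>" "F facet_of T" for T F
    unfolding u_def using integral_elem_trace_affine[OF that] Ab[OF that] by simp
  have jump_int: "(LINT x|face_measure F. jump \<T> F u x) = 0" if F: "F \<in> interior_faces \<T>" for F
  proof -
    note p = mesh_face_elem_plus[OF subsetD[OF interior_faces_subset F]] and q = interior_face_elem_minus[OF F]
    have flat: "flat_piece F" using subsetD[OF interior_faces_subset F] by (rule mesh_face_flat)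
    have i: "integrable (face_measure F) (elem_trace T u)" if "T \<in> \<T>" for T
      using elem_trace_measurable_bounded[OF that u] integrable_face_measure_bounded[OF flat] by blast
    have "(LINT x|face_measure F. jump \<T> F u x) =
      (LINT x|face_measure F. elem_trace (elem_plus \<T> F) u x - elem_trace (elem_minus \<T> F) u x)"
      using F by (simp add: jump_def)
    also have "\<dots> = 0"
      unfolding Bochner_Integration.integral_diff[OF i[OF p(1)] i[OF q(1)]] trace[OF p] trace[OF q] by simp
    finally show ?thesis .
  qed
  have jump_bd: "(LINT x|face_measure F. jump \<T> F u x) = face_area F *\<^sub>R m F"
    if "F \<in> mesh_faces \<T>" "F \<notin> interior_faces \<T>" for F
    using trace[OF mesh_face_elem_plus[OF that(1)]] that(2) by (simp add: jump_def)
  have jump_0: "(LINT x|face_measure F. jump \<T> F u x) = 0" if "F \<in> mesh_faces \<T>" "F \<notin> faces_on \<T> \<Gamma>D" for F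
    using jump_int jump_bd that by (cases "F \<in> interior_faces \<T>") (auto simp: m_def)
  have lin: "(LINT x|face_measure F. \<psi> (jump \<T> F u x)) = 0"
    if "F \<in> mesh_faces \<T>" "F \<notin> faces_on \<T> \<Gamma>D" "bounded_linear \<psi>" for F and \<psi> :: "real^'n \<Rightarrow> 'b::euclidean_space"
    using integral_bounded_linear[OF that(3) integrable_linear_jump[OF that(1) u bounded_linear_ident]]
    by (simp add: jump_0[OF that(1,2)] linear_0[OF bounded_linear.linear[OF that(3)]])
  have "u \<in> CR_space \<T> \<Gamma>D \<Gamma>S \<Gamma>E g"
    unfolding CR_space_iff[OF int]
  proof (intro conjI ballI)
    fix F assume F: "F \<in> faces_on \<T> \<Gamma>D"
    have mF: "F \<in> mesh_faces \<T>" using F faces_on_subset by blast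
    show "(LINT x|face_measure F. jump \<T> F u x) = (LINT x|face_measure F. g x)"
      using jump_bd[OF mF notint[OF F]] F integral_face_measure_null[OF mesh_face_flat[OF mF], of g]
      by (cases "face_area F = 0") (simp_all add: m_def)
  next
    fix F assume "F \<in> faces_on \<T> \<Gamma>S"
    then show "(LINT x|face_measure F. jump \<T> F u x \<bullet> outer_normal \<T> F) = 0"
      using notD faces_on_subset by (intro lin bounded_linear_inner_left) blast+
  next
    fix F assume "F \<in> faces_on \<T> \<Gamma>E"
    then show "(LINT x|face_measure F. tangential (outer_normal \<T> F) (jump \<T> F u x)) = 0"
      using notD faces_on_subset by (intro lin bounded_linear_tangential) blast+
  qed (use u jump_int in auto)
  then show ?thesis by blast
qed

end

section \<open>Linearity of the forms\<close>

text \<open>If the maximum is attained by 0, then \<open>p = 0\<close> and \<open>d \<ge> 0\<close>;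
  if it is attained by the other argument, then \<open>d = 0\<close> and
  \<open>p \<ge> 0\<close>.\<close>

lemma scaled_pos_part_fixpoint_iff:
  fixes \<gamma> p d :: real
  assumes "\<gamma> > 0"
  shows "1/\<gamma> * pos_part (\<gamma> * p - d) = p \<longleftrightarrow> 0 \<le> p \<and> 0 \<le> d \<and> p * d = 0"
proof -
  have "1/\<gamma> * pos_part (\<gamma> * p - d) = p \<longleftrightarrow> max 0 (\<gamma> * p - d) = \<gamma> * p"
    using assms by (auto simp: pos_part_def field_simps)
  also have "\<dots> \<longleftrightarrow> 0 \<le> \<gamma> * p \<and> 0 \<le> d \<and> (\<gamma> * p = 0 \<or> d = 0)"
    by (auto simp: max_def)
  also have "\<dots> \<longleftrightarrow> 0 \<le> p \<and> 0 \<le> d \<and> p * d = 0"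
    using assms by (auto simp: zero_le_mult_iff)
  finally show ?thesis .
qed

context simplicial_mesh
begin

section \<open>Elementwise constant gradients, strains and stresses, and the forms built on
  them\<close>

lemma broken_grad_const:
  assumes "v \<in> broken_P1 \<T>"
  shows "\<exists>A. broken_grad \<T> v = broken \<T> (\<lambda>T _. A T)"
  using assms broken_affine_grad unfolding broken_P1_iff by blast

lemma strain_const:
  assumes "v \<in> broken_P1 \<T>"
  shows "\<exists>S. strain \<T> v = broken \<T> (\<lambda>T _. S T)"
proof -
  obtain A where A: "broken_grad \<T> v = broken \<T> (\<lambda>T _. A T)" using broken_grad_const[OF assms] by blast
  have "strain \<T> v = broken \<T> (\<lambda>T _. (1/2) *\<^sub>R (A T + transpose (A T)))"
    by (rule brokenI) (simp_all add: strain_def A broken_eq broken_outside transpose_def vec_eq_iff)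
  then show ?thesis by (rule exI[of _ "\<lambda>T. (1/2) *\<^sub>R (A T + transpose (A T))"])
qed

lemma stress0_const:
  assumes "v \<in> broken_P1 \<T>"
  shows "\<exists>S. stress0 \<mu> \<T> v = broken \<T> (\<lambda>T _. S T)"
proof -
  obtain S where S: "strain \<T> v = broken \<T> (\<lambda>T _. S T)" using strain_const[OF assms] by blast
  obtain c where c: "broken_div \<T> v = broken \<T> (\<lambda>T _. c T)"
    using broken_div_P0[OF assms] unfolding broken_P0_iff by blast
  have "stress0 \<mu> \<T> v = broken \<T> (\<lambda>T _. (2 * \<mu>) *\<^sub>R (S T - (1/3 * c T) *\<^sub>R mat 1))"
    by (rule brokenI) (simp_all add: stress0_def S c broken_eq broken_outside)
  then show ?thesis by (rule exI[of _ "\<lambda>T. (2 * \<mu>) *\<^sub>R (S T - (1/3 * c T) *\<^sub>R mat 1)"])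
qed

lemma integrable_stress_strain:
  assumes "T \<in> \<T>" "u \<in> broken_P1 \<T>" "v \<in> broken_P1 \<T>"
  shows "integrable (lebesgue_on T) (\<lambda>x. stress0 \<mu> \<T> u x \<bullet> strain \<T> v x)"
proof -
  obtain S R where S: "stress0 \<mu> \<T> u = broken \<T> (\<lambda>T _. S T)" and R: "strain \<T> v = broken \<T> (\<lambda>T _. R T)"
    using stress0_const[OF assms(2)] strain_const[OF assms(3)] by metis
  obtain A B where "\<And>x. norm (broken \<T> (\<lambda>T _. S T) x) \<le> A" "\<And>x. norm (broken \<T> (\<lambda>T _. R T) x) \<le> B"
    using broken_bounded[of "\<lambda>T _. S T"] broken_bounded[of "\<lambda>T _. R T"] by auto
  moreover have "finite_measure (lebesgue_on T)"
    using elem_compact[OF assms(1)] lmeasurable_compact finite_measure_lebesgue_on by blast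
  ultimately show ?thesis
    unfolding S R
    by (intro integrable_inner_bounded[of _ _ _ A B] measurable_lebesgue_on_borel broken_measurable) auto
qed

lemma linear_fun_stress:
  assumes "T \<in> \<T>" "w \<in> broken_P1 \<T>"
  shows "linear_fun (broken_P1 \<T>) (\<lambda>v. LINT x|lebesgue_on T. stress0 \<mu> \<T> w x \<bullet> strain \<T> v x)"
    and "linear_fun (broken_P1 \<T>) (\<lambda>u. LINT x|lebesgue_on T. stress0 \<mu> \<T> u x \<bullet> strain \<T> w x)"
  unfolding linear_fun_def
  using integrable_stress_strain[OF assms(1)] assms(2)
  by (simp_all add: strain_comb stress0_comb inner_add_right inner_add_left)

lemma integrable_face_product:
  fixes \<psi> :: "real^'n \<Rightarrow> real^'n"
  assumes "F \<in> mesh_faces \<T>" "u \<in> broken_P1 \<T>" "v \<in> broken_P1 \<T>" "bounded_linear \<psi>"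
  shows "integrable (face_measure F) (\<lambda>x. k * (\<psi> (jump \<T> F u x) \<bullet> \<psi> (jump \<T> F v x)))"
proof -
  obtain A B where "\<And>x. norm (\<psi> (jump \<T> F u x)) \<le> A" "\<And>x. norm (\<psi> (jump \<T> F v x)) \<le> B"
    using linear_jump_measurable_bounded(2)[OF assms(1,2,4)] linear_jump_measurable_bounded(2)[OF assms(1,3,4)]
    by auto
  then show ?thesis
    using linear_jump_measurable_bounded(1)[OF assms(1,2,4)] linear_jump_measurable_bounded(1)[OF assms(1,3,4)]
      finite_face_measure[OF mesh_face_flat[OF assms(1)]]
    by (intro integrable_mult_right integrable_inner_bounded[of _ _ _ A B]) auto
qed

lemma linear_fun_face_product:
  fixes \<psi> :: "real^'n \<Rightarrow> real^'n"
  assumes F: "F \<in> mesh_faces \<T>" and w: "w \<in> broken_P1 \<T>" and \<psi>: "bounded_linear \<psi>"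
  shows "linear_fun (broken_P1 \<T>) (\<lambda>v. LINT x|face_measure F. k * (\<psi> (jump \<T> F w x) \<bullet> \<psi> (jump \<T> F v x)))" (is ?R)
    and "linear_fun (broken_P1 \<T>) (\<lambda>u. LINT x|face_measure F. k * (\<psi> (jump \<T> F u x) \<bullet> \<psi> (jump \<T> F w x)))" (is ?L)
proof -
  have lin: "linear (\<lambda>y. k * (\<psi> z \<bullet> \<psi> y))" for z
    using bounded_linear.linear[OF \<psi>]
    by (intro linearI) (simp_all add: linear_add linear_scale inner_add_right distrib_left)
  show ?R
    unfolding linear_fun_def
    using integral_jump_comb[OF F _ _ lin integrable_face_product[OF F w _ \<psi>]] by simp
  then show ?L by (simp add: inner_commute)
qed

lemma bilinear_fun_a_form:
  "bilinear_fun (broken_P1 \<T>) (a_form \<mu> \<gamma>\<^sub>1 \<T> \<Gamma>D \<Gamma>E)"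
proof -
  have F: "F \<in> mesh_faces \<T>" if "F \<in> interior_faces \<T> \<union> faces_on \<T> \<Gamma>D \<or> F \<in> faces_on \<T> \<Gamma>E" for F
    using that interior_faces_subset faces_on_subset by blast
  show ?thesis
    unfolding bilinear_fun_def a_form_def[abs_def]
    by (intro ballI conjI linear_fun_add linear_fun_scale linear_fun_sum linear_fun_stress
        linear_fun_face_product[OF F _ bounded_linear_ident] linear_fun_face_product[OF F _ bounded_linear_tangential])
      auto
qed

text \<open>The substance is integrability: discrete fields and their jumps are bounded, and
  square-integrable data are integrable because all measures involved are finite.\<close>

lemma linear_fun_load:
  assumes f: "square_integrable (lebesgue_on \<Omega>) f"
    and t: "\<forall>F\<in>faces_on \<T> \<Gamma>N. square_integrable (face_measure F) t"
    and p: "\<forall>F\<in>faces_on \<T> \<Gamma>E. square_integrable (face_measure F) p"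
  shows "linear_fun (broken_P1 \<T>) (load \<Omega> \<T> \<Gamma>N \<Gamma>E f t p)"
proof -
  have "linear_fun (broken_P1 \<T>) (\<lambda>v. LINT x|lebesgue_on \<Omega>. f x \<bullet> v x)"
  proof -
    have "integrable (lebesgue_on \<Omega>) (\<lambda>x. f x \<bullet> v x)" if v: "v \<in> broken_P1 \<T>" for v
    proof -
      obtain A b where v: "v = broken \<T> (\<lambda>T x. A T *v x + b T)" using v unfolding broken_P1_iff by blast
      have cont: "continuous_on UNIV (\<lambda>x. A T *v x + b T)" for T by (intro continuous_intros)
      obtain B where "\<And>x. norm (v x) \<le> B"
        using broken_bounded[of "\<lambda>T x. A T *v x + b T", OF cont] unfolding v by blast
      moreover have "v \<in> borel_measurable (lebesgue_on \<Omega>)"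
        unfolding v by (intro measurable_lebesgue_on_borel broken_measurable cont)
      ultimately show ?thesis
        using finite_measure_lebesgue_on[OF domain_lmeasurable] f by (intro square_integrable_inner_bounded)
    qed
    then show ?thesis unfolding linear_fun_def by (simp add: comb_def inner_add_right)
  qed
  moreover have "linear_fun (broken_P1 \<T>) (\<lambda>v. LINT x|face_measure F. t x \<bullet> jump \<T> F v x)"
    if "F \<in> faces_on \<T> \<Gamma>N" for F
  proof -
    have F: "F \<in> mesh_faces \<T>" using that faces_on_subset by blast
    have int: "integrable (face_measure F) (\<lambda>x. t x \<bullet> jump \<T> F w x)" if w: "w \<in> broken_P1 \<T>" for w
    proof -
      obtain B where "\<And>x. norm (jump \<T> F w x) \<le> B" using jump_measurable_bounded(2)[OF F w] by blast
      then show ?thesis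
        using finite_face_measure[OF mesh_face_flat[OF F]] t \<open>F \<in> faces_on \<T> \<Gamma>N\<close>
          jump_measurable_bounded(1)[OF F w]
        by (intro square_integrable_inner_bounded) auto
    qed
    have lin: "linear (\<lambda>y. t x \<bullet> y)" for x by (intro bounded_linear.linear bounded_linear_inner_right)
    show ?thesis unfolding linear_fun_def using integral_jump_comb[OF F _ _ lin int] by simp
  qed
  moreover have "linear_fun (broken_P1 \<T>) (\<lambda>v. LINT x|face_measure F. p x * (jump \<T> F v x \<bullet> outer_normal \<T> F))"
    if "F \<in> faces_on \<T> \<Gamma>E" for F
  proof -
    have F: "F \<in> mesh_faces \<T>" using that faces_on_subset by blast
    have int: "integrable (face_measure F) (\<lambda>x. p x * (jump \<T> F w x \<bullet> outer_normal \<T> F))"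
      if w: "w \<in> broken_P1 \<T>" for w
    proof -
      note j = linear_jump_measurable_bounded[OF F w bounded_linear_inner_left[of "outer_normal \<T> F"]]
      obtain B where "\<And>x. norm (jump \<T> F w x \<bullet> outer_normal \<T> F) \<le> B" using j(2) by blast
      then have "integrable (face_measure F) (\<lambda>x. p x \<bullet> (jump \<T> F w x \<bullet> outer_normal \<T> F))"
        using finite_face_measure[OF mesh_face_flat[OF F]] p \<open>F \<in> faces_on \<T> \<Gamma>E\<close> j(1)
        by (intro square_integrable_inner_bounded) auto
      then show ?thesis by simp
    qed
    have lin: "linear (\<lambda>y. p x * (y \<bullet> outer_normal \<T> F))" for x
      by (intro linearI) (simp_all add: inner_add_left distrib_left)
    show ?thesis unfolding linear_fun_def using integral_jump_comb[OF F _ _ lin int] by simp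
  qed
  ultimately show ?thesis
    unfolding load_def[abs_def] by (intro linear_fun_diff linear_fun_add linear_fun_sum)
qed

text \<open>Evaluation at one interior point reads off an elementwise constant, which turns
  integrals into finite sums over elements.\<close>

definition pt :: "(real^'n) set \<Rightarrow> real^'n" where
  "pt T = (SOME x. x \<in> interior T)"

lemma pt_in_interior: "T \<in> \<T> \<Longrightarrow> pt T \<in> interior T"
  unfolding pt_def using elem_interior_nonempty[of T] some_in_eq[of "interior T"] by simp

lemma broken_pt [simp]: "T \<in> \<T> \<Longrightarrow> broken \<T> h (pt T) = h T (pt T)"
  by (rule broken_eq[OF _ pt_in_interior])

text \<open>Supplies the finite separating family for the complementarity problem: an affine field
  is determined by its gradient and its value at one point.\<close>

lemma broken_P1_separated:
  obtains \<Phi> where "finite \<Phi>" "\<And>\<phi>. \<phi> \<in> \<Phi> \<Longrightarrow> linear_fun (broken_P1 \<T>) \<phi>"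
    "\<And>v. v \<in> broken_P1 \<T> \<Longrightarrow> (\<And>\<phi>. \<phi> \<in> \<Phi> \<Longrightarrow> \<phi> v = 0) \<Longrightarrow> v = (\<lambda>_. 0)"
proof -
  define \<Phi>1 where "\<Phi>1 = (\<lambda>(T, k) (v :: real^'n \<Rightarrow> real^'n). v (pt T) $ k) ` (\<T> \<times> UNIV)"
  define \<Phi>2 where "\<Phi>2 = (\<lambda>(T, i, j) v. broken_grad \<T> v (pt T) $ i $ j) ` (\<T> \<times> UNIV \<times> UNIV)"
  have "finite (\<Phi>1 \<union> \<Phi>2)" unfolding \<Phi>1_def \<Phi>2_def using finite_mesh by simp
  moreover have "linear_fun (broken_P1 \<T>) \<phi>" if "\<phi> \<in> \<Phi>1 \<union> \<Phi>2" for \<phi>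
    using that
  proof
    assume "\<phi> \<in> \<Phi>1"
    then show ?thesis by (auto simp: \<Phi>1_def linear_fun_def comb_def)
  next
    assume "\<phi> \<in> \<Phi>2"
    then show ?thesis by (auto simp: \<Phi>2_def linear_fun_def broken_grad_comb)
  qed
  moreover have "v = (\<lambda>_. 0)" if v: "v \<in> broken_P1 \<T>" and 0: "\<And>\<phi>. \<phi> \<in> \<Phi>1 \<union> \<Phi>2 \<Longrightarrow> \<phi> v = 0" for v
  proof -
    obtain A b where v: "v = broken \<T> (\<lambda>T x. A T *v x + b T)" using v unfolding broken_P1_iff by blast
    have A: "A T = 0" if T: "T \<in> \<T>" for T
    proof -
      have "broken_grad \<T> v (pt T) $ i $ j = 0" for i j
      proof -
        have "(\<lambda>v. broken_grad \<T> v (pt T) $ i $ j) \<in> \<Phi>2"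
          unfolding \<Phi>2_def by (rule image_eqI[of _ _ "(T, i, j)"]) (use T in auto)
        from 0[OF UnI2[OF this]] show ?thesis .
      qed
      then show ?thesis using T by (simp add: v broken_affine_grad vec_eq_iff)
    qed
    have b: "b T = 0" if T: "T \<in> \<T>" for T
    proof -
      have "v (pt T) $ k = 0" for k
      proof -
        have "(\<lambda>v. v (pt T) $ k) \<in> \<Phi>1"
          unfolding \<Phi>1_def by (rule image_eqI[of _ _ "(T, k)"]) (use T in auto)
        from 0[OF UnI1[OF this]] show ?thesis .
      qed
      then show ?thesis using T A by (simp add: v vec_eq_iff)
    qed
    show ?thesis unfolding v by (rule brokenI[symmetric]) (simp_all add: A b)
  qed
  ultimately show ?thesis by (rule that)
qed

section \<open>Reduction of the system to complementarity on each element\<close>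

lemma broken_P0_eq: "q \<in> broken_P0 \<T> \<Longrightarrow> q = broken \<T> (\<lambda>T _. q (pt T))"
  unfolding broken_P0_iff by (auto intro!: brokenI simp: broken_eq broken_outside)

text \<open>The condition at zero preserves the normalization off the element interiors. Three
  arguments accommodate pressure, divergence and test function.\<close>

lemma broken_P0_compose:
  assumes "q \<in> broken_P0 \<T>" "r \<in> broken_P0 \<T>" "s \<in> broken_P0 \<T>" "\<phi> 0 0 0 = 0"
  shows "(\<lambda>x. \<phi> (q x) (r x) (s x)) \<in> broken_P0 \<T>"
proof -
  obtain a b c where eq: "q = broken \<T> (\<lambda>T _. a T)" "r = broken \<T> (\<lambda>T _. b T)" "s = broken \<T> (\<lambda>T _. c T)"
    using assms(1-3) unfolding broken_P0_iff by blast
  have "(\<lambda>x. \<phi> (q x) (r x) (s x)) = broken \<T> (\<lambda>T _. \<phi> (a T) (b T) (c T))"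
    unfolding eq by (rule brokenI) (simp_all add: broken_eq broken_outside assms(4))
  then show ?thesis unfolding broken_P0_iff by (rule exI[of _ "\<lambda>T. \<phi> (a T) (b T) (c T)"])
qed

lemma integral_broken_P0:
  assumes "q \<in> broken_P0 \<T>"
  shows "(LINT x|lebesgue_on \<Omega>. q x) = (\<Sum>T\<in>\<T>. weight T * q (pt T))"
  by (subst broken_P0_eq[OF assms]) (rule integral_broken_const)

text \<open>Testing with the indicator of a single element isolates the scalar equation there,
  multiplied by a positive weight.\<close>

lemma projection_equation_iff:
  assumes p: "p \<in> broken_P0 \<T>" and d: "d \<in> broken_P0 \<T>" and \<gamma>: "\<gamma> > 0"
  shows "(\<forall>q\<in>broken_P0 \<T>. (LINT x|lebesgue_on \<Omega>. (1/\<gamma> * pos_part (\<gamma> * p x - d x) - p x) * q x) = 0) \<longleftrightarrow>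
    (\<forall>T\<in>\<T>. 0 \<le> p (pt T) \<and> 0 \<le> d (pt T) \<and> p (pt T) * d (pt T) = 0)" (is "?E \<longleftrightarrow> ?C")
proof -
  have int: "(LINT x|lebesgue_on \<Omega>. (1/\<gamma> * pos_part (\<gamma> * p x - d x) - p x) * q x) =
    (\<Sum>T\<in>\<T>. weight T * ((1/\<gamma> * pos_part (\<gamma> * p (pt T) - d (pt T)) - p (pt T)) * q (pt T)))"
    if "q \<in> broken_P0 \<T>" for q
    using broken_P0_compose[OF p d that, of "\<lambda>p d q. (1/\<gamma> * pos_part (\<gamma> * p - d) - p) * q"]
    by (intro integral_broken_P0) (simp add: pos_part_def)
  have "?E \<longleftrightarrow> (\<forall>T\<in>\<T>. 1/\<gamma> * pos_part (\<gamma> * p (pt T) - d (pt T)) = p (pt T))" (is "_ \<longleftrightarrow> ?P")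
  proof
    assume E: ?E
    show ?P
    proof
      fix T assume T: "T \<in> \<T>"
      let ?q = "broken \<T> (\<lambda>S _. if S = T then 1 else 0 :: real)"
      have q: "?q \<in> broken_P0 \<T>"
        unfolding broken_P0_iff by (rule exI[of _ "\<lambda>S. if S = T then 1 else 0"]) (rule refl)
      have "0 = (\<Sum>S\<in>\<T>. weight S * ((1/\<gamma> * pos_part (\<gamma> * p (pt S) - d (pt S)) - p (pt S)) * ?q (pt S)))"
        using bspec[OF E q] unfolding int[OF q] by simp
      also have "\<dots> = (\<Sum>S\<in>\<T>. if S = T then weight S * (1/\<gamma> * pos_part (\<gamma> * p (pt S) - d (pt S)) - p (pt S)) else 0)"
        by (intro sum.cong) auto
      also have "\<dots> = weight T * (1/\<gamma> * pos_part (\<gamma> * p (pt T) - d (pt T)) - p (pt T))"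
        using T finite_mesh by simp
      finally show "1/\<gamma> * pos_part (\<gamma> * p (pt T) - d (pt T)) = p (pt T)" using weight_pos[OF T] by simp
    qed
  next
    assume ?P
    then show ?E using int by simp
  qed
  then show ?thesis unfolding scaled_pos_part_fixpoint_iff[OF \<gamma>] .
qed

text \<open>Under complementarity the scaled positive part is \<open>p\<close> itself, so the
  nonlinear term of the first equation becomes linear in the pressure.\<close>

lemma integral_complementary:
  assumes p: "p \<in> broken_P0 \<T>" and d: "d \<in> broken_P0 \<T>" and \<gamma>: "\<gamma> > 0" and q: "q \<in> broken_P0 \<T>"
    and C: "\<forall>T\<in>\<T>. 0 \<le> p (pt T) \<and> 0 \<le> d (pt T) \<and> p (pt T) * d (pt T) = 0"
  shows "(LINT x|lebesgue_on \<Omega>. 1/\<gamma> * pos_part (\<gamma> * p x - d x) * q x) =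
    (\<Sum>T\<in>\<T>. weight T * (p (pt T) * q (pt T)))"
proof -
  have "(LINT x|lebesgue_on \<Omega>. 1/\<gamma> * pos_part (\<gamma> * p x - d x) * q x) =
    (\<Sum>T\<in>\<T>. weight T * (1/\<gamma> * pos_part (\<gamma> * p (pt T) - d (pt T)) * q (pt T)))"
    using broken_P0_compose[OF p d q, of "\<lambda>p d q. 1/\<gamma> * pos_part (\<gamma> * p - d) * q"]
    by (intro integral_broken_P0) (simp add: pos_part_def)
  also have "\<dots> = (\<Sum>T\<in>\<T>. weight T * (p (pt T) * q (pt T)))"
    using C unfolding scaled_pos_part_fixpoint_iff[OF \<gamma>, symmetric] by (intro sum.cong) auto
  finally show ?thesis .
qed

end


section \<open>The nonlinear system\<close>

theorem theorem3p4:
  fixes \<Omega> \<Gamma>D \<Gamma>N \<Gamma>S \<Gamma>E :: "(real^'n::finite) set"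
    and \<T> :: "(real^'n) set set"
    and f g t :: "real^'n \<Rightarrow> real^'n"
    and p\<^sub>b :: "real^'n \<Rightarrow> real"
    and \<mu> \<gamma>\<^sub>1 \<gamma> :: real
  defines "V \<equiv> CR_space \<T> \<Gamma>D \<Gamma>S \<Gamma>E"
    and "Q \<equiv> broken_P0 \<T>"
    and "a \<equiv> a_form \<mu> \<gamma>\<^sub>1 \<T> \<Gamma>D \<Gamma>E"
    and "L \<equiv> load \<Omega> \<T> \<Gamma>N \<Gamma>E f t p\<^sub>b"
    and "dv \<equiv> broken_div \<T>"
  assumes dim: "CARD('n) = 2 \<or> CARD('n) = 3"
    and dom: "polyhedral_lipschitz_domain \<Omega>"
    and part: "boundary_partition \<Omega> \<Gamma>D \<Gamma>N \<Gamma>S \<Gamma>E"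
    and mesh: "conforming_mesh \<Omega> \<T>"
    and resolve: "resolves_partition \<Omega> \<Gamma>D \<Gamma>N \<Gamma>S \<Gamma>E \<T>"
    and outflow: "faces_on \<T> (\<Gamma>N \<union> \<Gamma>E) \<noteq> {}"
    and g_int: "\<forall>F\<in>faces_on \<T> \<Gamma>D. integrable (face_measure F) g"
    and f_L2: "square_integrable (lebesgue_on \<Omega>) f"
    and t_L2: "\<forall>F\<in>faces_on \<T> \<Gamma>N. square_integrable (face_measure F) t"
    and pb_L2: "\<forall>F\<in>faces_on \<T> \<Gamma>E. square_integrable (face_measure F) p\<^sub>b"
    and mu: "\<mu> > 0" and gamma1: "\<gamma>\<^sub>1 > 0"
    and D_pos: "surface_area \<T> \<Gamma>D > 0"
    and a_posdef: "\<forall>v\<in>V (\<lambda>_. 0). v \<noteq> (\<lambda>_. 0) \<longrightarrow> a v v > 0"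
    and nondegenerate: "\<forall>q\<in>Q. (\<forall>v\<in>V (\<lambda>_. 0). (LINT x|lebesgue_on \<Omega>. q x * dv v x) = 0) \<longrightarrow> q = (\<lambda>_. 0)"
    and div_onto: "dv ` V (\<lambda>_. 0) = Q"
    and gamma: "\<gamma> > 0"
  shows "\<exists>!(u, p). u \<in> V g \<and> p \<in> Q \<and>
     (\<forall>v\<in>V (\<lambda>_. 0).
        a u v - (LINT x|lebesgue_on \<Omega>. 1/\<gamma> * pos_part (\<gamma> * p x - dv u x) * dv v x) = L v) \<and>
     (\<forall>q\<in>Q. (LINT x|lebesgue_on \<Omega>. (1/\<gamma> * pos_part (\<gamma> * p x - dv u x) - p x) * q x) = 0)"
proof -
  have \<Omega>: "open \<Omega>" "bounded \<Omega>" "lipschitz_domain \<Omega>"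
    using dom by (auto simp: polyhedral_lipschitz_domain_def)
  interpret simplicial_mesh \<Omega> \<T> by unfold_locales (use mesh \<Omega> in auto)
  let ?V0 = "V (\<lambda>_. 0)"
  have V_P1: "V w \<subseteq> broken_P1 \<T>" for w unfolding V_def by (rule CR_space_P1)
  have V0: "fun_subspace ?V0" unfolding V_def by (rule fun_subspace_CR_space)
  have V_add: "comb u c v \<in> V g" if "u \<in> V g" "v \<in> ?V0" for u v c
    using that unfolding V_def by (intro CR_space_comb[OF g_int _ g_int]) auto
  have V_diff: "comb u (- 1) u' \<in> ?V0" if "u \<in> V g" "u' \<in> V g" for u u'
    using that unfolding V_def by (intro CR_space_comb[OF g_int g_int]) auto
  have a: "bilinear_fun (broken_P1 \<T>) a" unfolding a_def by (rule bilinear_fun_a_form)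
  have L: "linear_fun (broken_P1 \<T>) L" unfolding L_def using f_L2 t_L2 pb_L2 by (rule linear_fun_load)
  have dv_Q: "dv u \<in> Q" if "u \<in> broken_P1 \<T>" for u
    unfolding dv_def Q_def using that by (rule broken_div_P0)
  have dv_comb: "dv (comb u c v) x = dv u x + c * dv v x"
    if "u \<in> broken_P1 \<T>" "v \<in> broken_P1 \<T>" for u v c x
    unfolding dv_def using that by (rule broken_div_comb)
  \<comment> \<open>The optimality system with the pressure as multiplier, in which
    \<open>\<gamma>\<close> no longer occurs; existence and uniqueness are both proved in this
    form.\<close>
  define sol where "sol u p \<longleftrightarrow> u \<in> V g \<and> p \<in> Q \<and>
      (\<forall>T\<in>\<T>. 0 \<le> p (pt T) \<and> 0 \<le> dv u (pt T) \<and> p (pt T) * dv u (pt T) = 0) \<and>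
      (\<forall>v\<in>?V0. a u v = L v + (\<Sum>T\<in>\<T>. weight T * (p (pt T) * dv v (pt T))))" for u p
  have sol_iff: "(u \<in> V g \<and> p \<in> Q \<and>
     (\<forall>v\<in>?V0. a u v - (LINT x|lebesgue_on \<Omega>. 1/\<gamma> * pos_part (\<gamma> * p x - dv u x) * dv v x) = L v) \<and>
     (\<forall>q\<in>Q. (LINT x|lebesgue_on \<Omega>. (1/\<gamma> * pos_part (\<gamma> * p x - dv u x) - p x) * q x) = 0)) \<longleftrightarrow> sol u p" for u p
  proof (cases "u \<in> V g \<and> p \<in> Q")
    case True
    have u: "u \<in> broken_P1 \<T>" using True V_P1 by blast
    have Q: "p \<in> broken_P0 \<T>" "dv u \<in> broken_P0 \<T>" using True dv_Q[OF u] by (auto simp: Q_def)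
    define C where "C \<longleftrightarrow> (\<forall>T\<in>\<T>. 0 \<le> p (pt T) \<and> 0 \<le> dv u (pt T) \<and> p (pt T) * dv u (pt T) = 0)"
    have second: "(\<forall>q\<in>Q. (LINT x|lebesgue_on \<Omega>. (1/\<gamma> * pos_part (\<gamma> * p x - dv u x) - p x) * q x) = 0) \<longleftrightarrow> C"
      unfolding Q_def C_def by (rule projection_equation_iff[OF Q gamma])
    have first: "(LINT x|lebesgue_on \<Omega>. 1/\<gamma> * pos_part (\<gamma> * p x - dv u x) * dv v x) =
      (\<Sum>T\<in>\<T>. weight T * (p (pt T) * dv v (pt T)))" if "C" "v \<in> ?V0" for v
      using that dv_Q[of v] V_P1 unfolding C_def Q_def by (intro integral_complementary[OF Q gamma]) auto
    have "(\<forall>v\<in>?V0. a u v - (LINT x|lebesgue_on \<Omega>. 1/\<gamma> * pos_part (\<gamma> * p x - dv u x) * dv v x) = L v) \<longleftrightarrow>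
      (\<forall>v\<in>?V0. a u v = L v + (\<Sum>T\<in>\<T>. weight T * (p (pt T) * dv v (pt T))))" if C
      by (rule ball_cong[OF refl]) (simp only: first[OF that] diff_eq_eq)
    then show ?thesis unfolding second sol_def C_def[symmetric] using True by blast
  qed (auto simp: sol_def)
  have "\<exists>u p. sol u p"
  proof -
    obtain u0 where u0: "u0 \<in> V g"
      using CR_space_nonempty[OF g_int \<Omega>(3) part] unfolding V_def by blast
    then have "dv u0 \<in> dv ` ?V0" using dv_Q V_P1 div_onto by blast
    then obtain v0 where v0: "v0 \<in> ?V0" "dv v0 = dv u0" by auto
    \<comment> \<open>\<open>v0\<close> has homogeneous face conditions and the divergence of
      \<open>u0\<close>, so \<open>w\<close> keeps the Dirichlet data and is
      divergence-free.\<close>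
    define w where "w = comb u0 (- 1) v0"
    have w: "w \<in> V g" unfolding w_def using u0 v0(1) by (rule V_add)
    have wP1: "w \<in> broken_P1 \<T>" using w V_P1 by blast
    have dv_w: "dv w x = 0" for x
      unfolding w_def using dv_comb[of u0 v0 "- 1" x] u0 v0 V_P1 by auto
    obtain \<Phi> where \<Phi>: "finite \<Phi>" "\<And>\<phi>. \<phi> \<in> \<Phi> \<Longrightarrow> linear_fun (broken_P1 \<T>) \<phi>"
      "\<And>v. v \<in> broken_P1 \<T> \<Longrightarrow> (\<And>\<phi>. \<phi> \<in> \<Phi> \<Longrightarrow> \<phi> v = 0) \<Longrightarrow> v = (\<lambda>_. 0)"
      using broken_P1_separated by blast
    \<comment> \<open>The full velocity is \<open>w + u\<close>, which moves \<open>a w\<close> into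
      the right-hand side. Each constraint functional carries the factor \<open>weight T\<close>, so
      that its multiplier is exactly the pressure on \<open>T\<close>.\<close>
    have "\<exists>u\<in>?V0. \<exists>p. (\<forall>T\<in>\<T>. p T \<ge> (0::real) \<and> weight T * dv u (pt T) \<ge> 0 \<and> p T * (weight T * dv u (pt T)) = 0) \<and>
      (\<forall>v\<in>?V0. a u v = (L v - a w v) + (\<Sum>T\<in>\<T>. p T * (weight T * dv v (pt T))))"
    proof (rule complementarity_solution_exists[OF finite_mesh \<Phi>(1) V0])
      show "linear_fun ?V0 \<phi>" if "\<phi> \<in> \<Phi>" for \<phi> using \<Phi>(2)[OF that] V_P1 by (rule linear_fun_subset)
      show "v = (\<lambda>_. 0)" if "v \<in> ?V0" "\<And>\<phi>. \<phi> \<in> \<Phi> \<Longrightarrow> \<phi> v = 0" for v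
        using subsetD[OF V_P1 that(1)] that(2) by (rule \<Phi>(3))
      show "bilinear_fun ?V0 a" using a V_P1 by (rule bilinear_fun_subset)
      show "0 < a v v" if "v \<in> ?V0" "v \<noteq> (\<lambda>_. 0)" for v using a_posdef that by blast
      have "linear_fun (broken_P1 \<T>) (a w)" using a wP1 by (auto simp: bilinear_fun_def)
      from linear_fun_diff[OF L this] show "linear_fun ?V0 (\<lambda>v. L v - a w v)"
        using V_P1 by (rule linear_fun_subset)
      have "linear_fun (broken_P1 \<T>) (\<lambda>v. weight T * dv v (pt T))" for T
        using dv_comb by (auto simp: linear_fun_def algebra_simps)
      from this V_P1 show "linear_fun ?V0 (\<lambda>v. weight T * dv v (pt T))" for T by (rule linear_fun_subset)
    qed
    then obtain u p where u: "u \<in> ?V0"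
      and p: "\<And>T. T \<in> \<T> \<Longrightarrow> p T \<ge> (0::real) \<and> weight T * dv u (pt T) \<ge> 0 \<and> p T * (weight T * dv u (pt T)) = 0"
      and eq: "\<And>v. v \<in> ?V0 \<Longrightarrow> a u v = (L v - a w v) + (\<Sum>T\<in>\<T>. p T * (weight T * dv v (pt T)))"
      by blast
    have uP1: "u \<in> broken_P1 \<T>" using u V_P1 by blast
    define P where "P = broken \<T> (\<lambda>T _. p T)"
    have "sol (comb w 1 u) P"
      unfolding sol_def
    proof (intro conjI)
      show "comb w 1 u \<in> V g" using w u by (rule V_add)
      show "P \<in> Q" unfolding Q_def P_def broken_P0_iff by (rule exI[of _ p]) (rule refl)
      have dv_eq: "dv (comb w 1 u) x = dv u x" for x using dv_comb[OF wP1 uP1] dv_w by simp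
      have "0 \<le> P (pt T) \<and> 0 \<le> dv (comb w 1 u) (pt T) \<and> P (pt T) * dv (comb w 1 u) (pt T) = 0" if T: "T \<in> \<T>" for T
        using p[OF T] weight_pos[OF T] T by (auto simp: P_def dv_eq zero_le_mult_iff)
      then show "\<forall>T\<in>\<T>. 0 \<le> P (pt T) \<and> 0 \<le> dv (comb w 1 u) (pt T) \<and> P (pt T) * dv (comb w 1 u) (pt T) = 0"
        by blast
      have "a (comb w 1 u) v = L v + (\<Sum>T\<in>\<T>. weight T * (P (pt T) * dv v (pt T)))" if v: "v \<in> ?V0" for v
      proof -
        have "(\<Sum>T\<in>\<T>. weight T * (P (pt T) * dv v (pt T))) = (\<Sum>T\<in>\<T>. p T * (weight T * dv v (pt T)))"
          by (intro sum.cong) (auto simp: P_def)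
        then show ?thesis
          using eq[OF v] bilinear_fun_comb_left[OF a wP1 uP1 subsetD[OF V_P1 v], of 1] by simp
      qed
      then show "\<forall>v\<in>?V0. a (comb w 1 u) v = L v + (\<Sum>T\<in>\<T>. weight T * (P (pt T) * dv v (pt T)))"
        by blast
    qed
    then show ?thesis by blast
  qed
  then obtain U P where UP: "sol U P" by blast
  have unique: "u = U \<and> p = P" if "sol u p" for u p
  proof -
    have s: "u \<in> V g" "p \<in> Q" "U \<in> V g" "P \<in> Q"
      and c: "\<And>T. T \<in> \<T> \<Longrightarrow> 0 \<le> p (pt T) \<and> 0 \<le> dv u (pt T) \<and> p (pt T) * dv u (pt T) = 0"
        "\<And>T. T \<in> \<T> \<Longrightarrow> 0 \<le> P (pt T) \<and> 0 \<le> dv U (pt T) \<and> P (pt T) * dv U (pt T) = 0"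
      and e: "\<And>v. v \<in> ?V0 \<Longrightarrow> a u v = L v + (\<Sum>T\<in>\<T>. weight T * (p (pt T) * dv v (pt T)))"
        "\<And>v. v \<in> ?V0 \<Longrightarrow> a U v = L v + (\<Sum>T\<in>\<T>. weight T * (P (pt T) * dv v (pt T)))"
      using that UP unfolding sol_def by blast+
    have P1: "u \<in> broken_P1 \<T>" "U \<in> broken_P1 \<T>" using s V_P1 by blast+
    define z where "z = comb u (- 1) U"
    have z: "z \<in> ?V0" unfolding z_def using s by (intro V_diff)
    have "a z z = a u z - a U z"
      using bilinear_fun_comb_left[OF a P1 subsetD[OF V_P1 z], of "- 1"] by (simp add: z_def[symmetric])
    also have "\<dots> = (\<Sum>T\<in>\<T>. weight T * (p (pt T) * dv z (pt T)) - weight T * (P (pt T) * dv z (pt T)))"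
      using e[OF z] by (simp add: sum_subtractf)
    \<comment> \<open>On each element the products of a pressure with the divergence of its own
      velocity vanish; the mixed products are nonnegative and occur with a minus sign.\<close>
    also have "\<dots> \<le> 0"
    proof (rule sum_nonpos)
      fix T assume T: "T \<in> \<T>"
      have dz: "dv z (pt T) = dv u (pt T) - dv U (pt T)" unfolding z_def using dv_comb[OF P1] by simp
      have "p (pt T) * dv U (pt T) \<ge> 0" "P (pt T) * dv u (pt T) \<ge> 0" using c[OF T] by auto
      then have "p (pt T) * dv z (pt T) \<le> P (pt T) * dv z (pt T)"
        using c[OF T] unfolding dz right_diff_distrib by linarith
      then show "weight T * (p (pt T) * dv z (pt T)) - weight T * (P (pt T) * dv z (pt T)) \<le> 0"
        using weight_pos[OF T] by simp
    qed
    finally have "z = (\<lambda>_. 0)" using a_posdef z by fastforce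
    then have "u x = U x" for x by (simp add: z_def comb_def fun_eq_iff)
    then have uU: "u = U" by blast
    have pP: "p \<in> broken_P0 \<T>" "P \<in> broken_P0 \<T>" using s by (auto simp: Q_def)
    \<comment> \<open>With equal velocities the two momentum equations differ only in the pressure
      term, so \<open>q\<close> is orthogonal to every \<open>dv v\<close> and nondegeneracy
      applies.\<close>
    define q where "q x = p x - P x" for x
    have q: "q \<in> broken_P0 \<T>"
      unfolding q_def[abs_def] using broken_P0_compose[OF pP pP(1), of "\<lambda>p P _. p - P"] by simp
    have "(LINT x|lebesgue_on \<Omega>. q x * dv v x) = 0" if v: "v \<in> ?V0" for v
    proof -
      have "dv v \<in> broken_P0 \<T>" using dv_Q V_P1 v unfolding Q_def by blast
      then have "(\<lambda>x. q x * dv v x) \<in> broken_P0 \<T>"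
        using broken_P0_compose[OF q _ q, of "dv v" "\<lambda>q d _. q * d"] by simp
      then have "(LINT x|lebesgue_on \<Omega>. q x * dv v x) = (\<Sum>T\<in>\<T>. weight T * (q (pt T) * dv v (pt T)))"
        by (rule integral_broken_P0)
      also have "\<dots> = (\<Sum>T\<in>\<T>. weight T * (p (pt T) * dv v (pt T))) - (\<Sum>T\<in>\<T>. weight T * (P (pt T) * dv v (pt T)))"
        by (simp add: q_def algebra_simps sum_subtractf)
      also have "\<dots> = 0" using e[OF v] uU by simp
      finally show ?thesis .
    qed
    then have "q = (\<lambda>_. 0)" using nondegenerate q unfolding Q_def by blast
    then have "p x = P x" for x by (simp add: q_def fun_eq_iff)
    then show ?thesis using uU by blast
  qed
  show ?thesis
    unfolding sol_iff
  proof (rule ex1I[of _ "(U, P)"])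
    show "case (U, P) of (u, p) \<Rightarrow> sol u p" using UP by simp
    show "y = (U, P)" if "case y of (u, p) \<Rightarrow> sol u p" for y
      using that unique by (cases y) simp
  qed
qed

end
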